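(* Let $(E,\langle\cdot,\cdot\rangle_E)$ be a real Hilbert space with $\|\cdot\|_E=\sqrt{\langle\cdot,\cdot\rangle_E}$. Let $(E,\mathcal D,\mathcal J)$ be a symplectic Banach triple, $H\in C^2(E,\mathbb R)\cap\mathrm{Dif}(\mathcal D,\mathcal J)$, $G$ a Lie group with a globally Hamiltonian action $\Phi$ on $E$ with $\mathrm{Ad}^*$-equivariant momentum map $F\in C^2(E,\mathbb R^m)$, and suppose $H\circ\Phi_g=H$ for all $g\in G$. Let $\Omega\subset\mathfrak g\simeq\mathbb R^m$ be open and let $\tilde u\in C^1(\Omega,E)$, $\tilde u(\xi)=u_\xi\in\mathcal D$, satisfy $D_{u_\xi}H-\xi\cdot D_{u_\xi}F=0$ for all $\xi\in\Omega$. Write $\mathcal L_\xi=H-\xi\cdot F$, $\mu_\xi=F(u_\xi)$ and $W:\Omega\to\mathbb R$, $W(\xi)=\mathcal L_\xi(u_\xi)$. Let $\xi\in\Omega$ and suppose (i) $D^2_\xi W$ is non-degenerate; (ii) $\mathrm{Ker}\,D^2_{u_\xi}\mathcal L_\xi=T_{u_\xi}\mathcal O_{u_\xi}$; (iii) $\inf\big(\sigma(\nabla^2\mathcal L_\xi(u_\xi))\cap(0,+\infty)\big)>0$; (iv) $p(D^2_\xi W)=n(D^2_{u_\xi}\mathcal L_\xi)$. Then there exists $\delta>0$ such that $$\forall v\in T_{u_\xi}\Sigma_{\mu_\xi}\cap(T_{u_\xi}\mathcal O_{u_\xi})^\perp,\qquad D^2_{u_\xi}\mathcal L_\xi(v,v)\ge\delta\|v\|_E^2,$$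 where $\perp$ denotes orthogonality with respect to $\langle\cdot,\cdot\rangle_E$.
   Context: Symplectic setting. Let $E$ be a real Banach space with norm $\|\cdot\|_E$. A domain $\mathcal D$ is a dense subset of $E$. A symplector is an injective continuous linear map $\mathcal J:E\to E^*$ with $(\mathcal Ju)(v)=-(\mathcal Jv)(u)$; then $(E,\mathcal D,\mathcal J)$ is called a symplectic Banach triple. $\mathrm{Dif}(\mathcal D,\mathcal J)$ is the set of functions $H:E\to\mathbb R$ differentiable at each $u\in\mathcal D$ with $D_uH$ in the range of $\mathcal J$ for all $u\in\mathcal D$. A Hamiltonian flow for $H\in\mathrm{Dif}(\mathcal D,\mathcal J)$ is a separately continuous map $\Phi^H:\mathbb R\times E\to E$ such that $\Phi^H_{t+s}=\Phi^H_t\circ\Phi^H_s$, $\Phi^H_0=\mathrm{Id}$, $\Phi^H_t(\mathcal D)=\mathcal D$, and for $u\in\mathcal D$ the curve $u(t)=\Phi^H_t(u)$ is differentiable and is the unique solution of $\mathcal J\dot u(t)=D_{u(t)}H$, $u(0)=u$. Group action. $G$ is a connected matrix Lie group with Lie algebra $\mathfrak g$, $m=\dim\mathfrak g$, $\mathrm{Ad}_g\xi=g\xi g^{-1}$; $\mathfrak g$ and $\mathfrak g^*$ are identified with $\mathbb R^m$ and $\cdot$ is the canonical inner product of $\mathbb R^m$. An action $\Phi$ of $G$ on $E$ is globally Hamiltonian if: each $\Phi_g\in C^1(E,E)$ satisfies $(\mathcal JD_u\Phi_g v)(D_u\Phi_g w)=(\mathcal Jv)(w)$ for all $u\in\mathcal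 D$, $v,w\in E$; $\Phi_g(\mathcal D)=\mathcal D$; and for each $\xi\in\mathfrak g$ there is $F_\xi\in C^1(E,\mathbb R)\cap\mathrm{Dif}(\mathcal D,\mathcal J)$, linear in $\xi$, such that $\Phi_{\exp(t\xi)}=\Phi_t^{F_\xi}$ is a Hamiltonian flow. The momentum map is $F:E\to\mathbb R^m\simeq\mathfrak g^*$ with $F_\xi=\xi\cdot F$; it is $\mathrm{Ad}^*$-equivariant if $F_\xi\circ\Phi_g=F_{\mathrm{Ad}_{g^{-1}}\xi}$ for all $g,\xi$, i.e. $F\circ\Phi_g=\mathrm{Ad}^*_gF$. For $u\in\mathcal D$, $X_\eta(u)=\frac{d}{dt}\Phi_{\exp(t\eta)}(u)|_{t=0}$. For $\mu\in\mathfrak g^*$: $G_\mu=\{g\in G:\mathrm{Ad}^*_g\mu=\mu\}$ with Lie algebra $\mathfrak g_\mu$; $\Sigma_\mu=\{u\in E:F(u)=\mu\}$; $T_u\Sigma_\mu=\mathrm{Ker}\,D_uF$ for $u\in\Sigma_\mu$. For $u\in\mathcal D$ with $\mu=F(u)$: $\mathcal O_u=\Phi_{G_\mu}(u)$ and $T_u\mathcal O_u=\{X_\eta(u):\eta\in\mathfrak g_\mu\}$. Hessians. $D^2_\xi W$ is the Hessian of $W$ at $\xi$, a symmetric bilinear form on $\mathbb R^m$; $p(D^2_\xi W)$ is the dimension of a maximal positive definite subspace of it. $n(D^2_u\mathcal L_\xi)$ is the Morse index: the dimension of a maximal negative definite subspace of $E$ for the symmetric bilinear form $D^2_u\mathcal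 L_\xi$. The kernel of a symmetric bilinear form $B$ is $\{v:B(v,w)=0\ \forall w\}$. When $E$ is a Hilbert space, $\nabla^2\mathcal L_\xi(u)$ is the bounded self-adjoint operator on $E$ given by $\langle v,\nabla^2\mathcal L_\xi(u)w\rangle_E=D^2_u\mathcal L_\xi(v,w)$; $\sigma$ denotes its spectrum. *)

theory Defs
  imports "HOL-Analysis.Analysis"
begin

definition fderiv :: "('a::real_normed_vector \<Rightarrow> 'b::real_normed_vector) \<Rightarrow> 'a \<Rightarrow> 'a \<Rightarrow>\<^sub>L 'b" where
  "fderiv f x = Blinfun (frechet_derivative f (at x))"

text \<open>The next two notions are meant for open \<open>S\<close>; continuity of the derivative is with respect to
  the operator norm.\<close>

definition C1_on :: "'a::real_normed_vector set \<Rightarrow> ('a \<Rightarrow> 'b::real_normed_vector) \<Rightarrow> bool" where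
  "C1_on S f \<longleftrightarrow> (\<forall>x\<in>S. f differentiable (at x)) \<and> continuous_on S (fderiv f)"

definition C2_on :: "'a::real_normed_vector set \<Rightarrow> ('a \<Rightarrow> 'b::real_normed_vector) \<Rightarrow> bool" where
  "C2_on S f \<longleftrightarrow> C1_on S f \<and> C1_on S (fderiv f)"

definition hessian :: "('a::real_normed_vector \<Rightarrow> real) \<Rightarrow> 'a \<Rightarrow> 'a \<Rightarrow> 'a \<Rightarrow> real" where
  "hessian f x v w = blinfun_apply (blinfun_apply (fderiv (fderiv f) x) v) w"

definition form_kernel :: "('a::real_vector \<Rightarrow> 'a \<Rightarrow> real) \<Rightarrow> 'a set" where
  "form_kernel B = {v. \<forall>w. B v w = 0}"

definition nondegenerate :: "('a::real_vector \<Rightarrow> 'a \<Rightarrow> real) \<Rightarrow> bool" where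
  "nondegenerate B \<longleftrightarrow> form_kernel B = {0}"

text \<open>The library's \<^const>\<open>dim\<close> is a natural number and carries no information about
  infinite-dimensional subspaces.\<close>

definition edim :: "'a::real_vector set \<Rightarrow> enat" where
  "edim V = (if \<exists>S. finite S \<and> V \<subseteq> span S then enat (dim V) else \<infinity>)"

definition positive_index :: "('a::real_vector \<Rightarrow> 'a \<Rightarrow> real) \<Rightarrow> enat" where
  "positive_index B = (SUP V \<in> {V. subspace V \<and> (\<forall>v\<in>V. v \<noteq> 0 \<longrightarrow> B v v > 0)}. edim V)"

definition morse_index :: "('a::real_vector \<Rightarrow> 'a \<Rightarrow> real) \<Rightarrow> enat" where
  "morse_index B = (SUP V \<in> {V. subspace V \<and> (\<forall>v\<in>V. v \<noteq> 0 \<longrightarrow> B v v < 0)}. edim V)"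

text \<open>Existence and uniqueness of the described operator is the Riesz representation theorem
  (when \<open>f\<close> is twice differentiable at \<open>x\<close>).\<close>

definition hessian_op :: "('e::{real_inner,complete_space} \<Rightarrow> real) \<Rightarrow> 'e \<Rightarrow> 'e \<Rightarrow>\<^sub>L 'e" where
  "hessian_op f x = (THE A. \<forall>v w. v \<bullet> blinfun_apply A w = hessian f x v w)"

text \<open>Real spectrum. It is the whole spectrum of the complexification when the operator is
  self-adjoint, the only case in which it is used here.\<close>

definition spectrum :: "('e::real_normed_vector \<Rightarrow>\<^sub>L 'e) \<Rightarrow> real set" where
  "spectrum A = {c. \<not> (\<exists>R. R o\<^sub>L (A - c *\<^sub>R id_blinfun) = id_blinfun \<and>
                           (A - c *\<^sub>R id_blinfun) o\<^sub>L R = id_blinfun)}"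

definition symplectic_triple ::
  "'e::banach set \<Rightarrow> ('e \<Rightarrow>\<^sub>L 'e \<Rightarrow>\<^sub>L real) \<Rightarrow> bool" where
  "symplectic_triple D J \<longleftrightarrow> closure D = UNIV \<and> inj (blinfun_apply J) \<and>
     (\<forall>u v. blinfun_apply (blinfun_apply J u) v = - blinfun_apply (blinfun_apply J v) u)"

definition Dif :: "'e::banach set \<Rightarrow> ('e \<Rightarrow>\<^sub>L 'e \<Rightarrow>\<^sub>L real) \<Rightarrow> ('e \<Rightarrow> real) set" where
  "Dif D J = {H. \<forall>u\<in>D. H differentiable (at u) \<and> fderiv H u \<in> range (blinfun_apply J)}"

text \<open>Solution curves stay in \<open>D\<close>, since only there an \<open>H \<in> Dif D J\<close> is known to be
  differentiable.\<close>

definition hamiltonian_solution ::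
  "'e::banach set \<Rightarrow> ('e \<Rightarrow>\<^sub>L 'e \<Rightarrow>\<^sub>L real) \<Rightarrow> ('e \<Rightarrow> real) \<Rightarrow> 'e \<Rightarrow> (real \<Rightarrow> 'e) \<Rightarrow> bool" where
  "hamiltonian_solution D J H u c \<longleftrightarrow> c 0 = u \<and>
     (\<forall>t. c t \<in> D \<and> c differentiable (at t) \<and>
          blinfun_apply J (vector_derivative c (at t)) = fderiv H (c t))"

definition hamiltonian_flow ::
  "'e::banach set \<Rightarrow> ('e \<Rightarrow>\<^sub>L 'e \<Rightarrow>\<^sub>L real) \<Rightarrow> ('e \<Rightarrow> real) \<Rightarrow> (real \<Rightarrow> 'e \<Rightarrow> 'e) \<Rightarrow> bool" where
  "hamiltonian_flow D J H \<phi> \<longleftrightarrow>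
     (\<forall>t. continuous_on UNIV (\<phi> t)) \<and> (\<forall>u. continuous_on UNIV (\<lambda>t. \<phi> t u)) \<and>
     (\<forall>t s. \<phi> (t + s) = \<phi> t \<circ> \<phi> s) \<and> \<phi> 0 = id \<and> (\<forall>t. \<phi> t ` D = D) \<and>
     (\<forall>u\<in>D. hamiltonian_solution D J H u (\<lambda>t. \<phi> t u) \<and>
        (\<forall>c. hamiltonian_solution D J H u c \<longrightarrow> c = (\<lambda>t. \<phi> t u)))"

text \<open>On vectors and matrices the library's \<open>*\<close> and \<open>^\<close> act componentwise, so powers and the
  exponential are built from \<open>**\<close>.\<close>

primrec mat_pow :: "complex^'n^'n \<Rightarrow> nat \<Rightarrow> complex^'n^'n" where
  "mat_pow A 0 = mat 1"
| "mat_pow A (Suc k) = A ** mat_pow A k"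

definition mat_exp :: "complex^'n^'n \<Rightarrow> complex^'n^'n" where
  "mat_exp A = (\<Sum>k. (1 / fact k) *\<^sub>R mat_pow A k)"

text \<open>A matrix Lie group is a subgroup of \<open>GL(n,\<complex>)\<close> that is closed in \<open>GL(n,\<complex>)\<close>; this includes
  the groups of real matrices.\<close>

definition matrix_lie_group :: "(complex^'n^'n) set \<Rightarrow> bool" where
  "matrix_lie_group G \<longleftrightarrow> closedin (top_of_set {A. invertible A}) G \<and> mat 1 \<in> G \<and>
     (\<forall>g\<in>G. \<forall>h\<in>G. g ** h \<in> G) \<and> (\<forall>g\<in>G. matrix_inv g \<in> G)"

definition lie_algebra :: "(complex^'n^'n) set \<Rightarrow> (complex^'n^'n) set" where
  "lie_algebra G = {X. \<forall>t::real. mat_exp (t *\<^sub>R X) \<in> G}"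

text \<open>\<open>\<iota>\<close> is the identification of \<open>\<real>\<^sup>m\<close> with the Lie algebra, \<open>m\<close> being the dimension of the latter.
  The Euclidean space \<open>\<real>\<^sup>m\<close> is rendered as a type \<open>'g\<close> of class \<^class>\<open>real_inner\<close>: it has dimension
  \<open>m\<close> because \<open>\<iota>\<close> is a linear bijection onto the Lie algebra. Both \<open>real^'m\<close> and the class
  \<^class>\<open>euclidean_space\<close> would exclude \<open>m = 0\<close>. The inner product of \<open>'g\<close> also identifies \<open>'g\<close> with
  its dual.\<close>

definition lie_coordinates :: "(complex^'n^'n) set \<Rightarrow> ('g::real_inner \<Rightarrow> complex^'n^'n) \<Rightarrow> bool" where
  "lie_coordinates G \<iota> \<longleftrightarrow> linear \<iota> \<and> inj \<iota> \<and> range \<iota> = lie_algebra G"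

definition Ad :: "('g::real_inner \<Rightarrow> complex^'n^'n) \<Rightarrow> complex^'n^'n \<Rightarrow> 'g \<Rightarrow> 'g" where
  "Ad \<iota> g \<xi> = inv \<iota> (g ** \<iota> \<xi> ** matrix_inv g)"

definition Ad_star :: "('g::real_inner \<Rightarrow> complex^'n^'n) \<Rightarrow> complex^'n^'n \<Rightarrow> 'g \<Rightarrow> 'g" where
  "Ad_star \<iota> g = adjoint (Ad \<iota> (matrix_inv g))"

definition isotropy_group ::
  "(complex^'n^'n) set \<Rightarrow> ('g::real_inner \<Rightarrow> complex^'n^'n) \<Rightarrow> 'g \<Rightarrow> (complex^'n^'n) set" where
  "isotropy_group G \<iota> \<mu> = {g \<in> G. Ad_star \<iota> g \<mu> = \<mu>}"

definition isotropy_algebra ::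
  "(complex^'n^'n) set \<Rightarrow> ('g::real_inner \<Rightarrow> complex^'n^'n) \<Rightarrow> 'g \<Rightarrow> 'g set" where
  "isotropy_algebra G \<iota> \<mu> = {\<eta>. \<iota> \<eta> \<in> lie_algebra (isotropy_group G \<iota> \<mu>)}"

definition group_action_on ::
  "(complex^'n^'n) set \<Rightarrow> (complex^'n^'n \<Rightarrow> 'e \<Rightarrow> 'e) \<Rightarrow> bool" where
  "group_action_on G \<Phi> \<longleftrightarrow> \<Phi> (mat 1) = id \<and> (\<forall>g\<in>G. \<forall>h\<in>G. \<Phi> (g ** h) = \<Phi> g \<circ> \<Phi> h)"

text \<open>The generators \<open>F\<^sub>\<xi>\<close> enter through the momentum map, \<open>F\<^sub>\<xi> = \<xi> \<bullet> F\<close>, which makes them linear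
  in \<open>\<xi>\<close>.\<close>

definition globally_hamiltonian ::
  "(complex^'n^'n) set \<Rightarrow> ('g::real_inner \<Rightarrow> complex^'n^'n) \<Rightarrow> 'e::banach set \<Rightarrow>
   ('e \<Rightarrow>\<^sub>L 'e \<Rightarrow>\<^sub>L real) \<Rightarrow> (complex^'n^'n \<Rightarrow> 'e \<Rightarrow> 'e) \<Rightarrow> ('e \<Rightarrow> 'g) \<Rightarrow> bool" where
  "globally_hamiltonian G \<iota> D J \<Phi> F \<longleftrightarrow> group_action_on G \<Phi> \<and>
     (\<forall>g\<in>G. C1_on UNIV (\<Phi> g) \<and> \<Phi> g ` D = D \<and>
        (\<forall>u\<in>D. \<forall>v w. blinfun_apply (blinfun_apply J (blinfun_apply (fderiv (\<Phi> g) u) v))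
                         (blinfun_apply (fderiv (\<Phi> g) u) w)
                     = blinfun_apply (blinfun_apply J v) w)) \<and>
     (\<forall>\<xi>. C1_on UNIV (\<lambda>u. \<xi> \<bullet> F u) \<and> (\<lambda>u. \<xi> \<bullet> F u) \<in> Dif D J \<and>
        hamiltonian_flow D J (\<lambda>u. \<xi> \<bullet> F u) (\<lambda>t. \<Phi> (mat_exp (t *\<^sub>R \<iota> \<xi>))))"

definition Ad_star_equivariant ::
  "(complex^'n^'n) set \<Rightarrow> ('g::real_inner \<Rightarrow> complex^'n^'n) \<Rightarrow>
   (complex^'n^'n \<Rightarrow> 'e \<Rightarrow> 'e) \<Rightarrow> ('e \<Rightarrow> 'g) \<Rightarrow> bool" where
  "Ad_star_equivariant G \<iota> \<Phi> F \<longleftrightarrow>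
     (\<forall>g\<in>G. \<forall>\<xi> u. \<xi> \<bullet> F (\<Phi> g u) = Ad \<iota> (matrix_inv g) \<xi> \<bullet> F u)"

definition generator ::
  "('g::real_inner \<Rightarrow> complex^'n^'n) \<Rightarrow> (complex^'n^'n \<Rightarrow> 'e::real_normed_vector \<Rightarrow> 'e) \<Rightarrow> 'g \<Rightarrow> 'e \<Rightarrow> 'e" where
  "generator \<iota> \<Phi> \<eta> u = vector_derivative (\<lambda>t. \<Phi> (mat_exp (t *\<^sub>R \<iota> \<eta>)) u) (at 0)"

definition tangent_level ::
  "('e::real_normed_vector \<Rightarrow> 'g::real_inner) \<Rightarrow> 'e \<Rightarrow> 'e set" where
  "tangent_level F u = {v. blinfun_apply (fderiv F u) v = 0}"

definition tangent_orbit ::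
  "(complex^'n^'n) set \<Rightarrow> ('g::real_inner \<Rightarrow> complex^'n^'n) \<Rightarrow>
   (complex^'n^'n \<Rightarrow> 'e::real_normed_vector \<Rightarrow> 'e) \<Rightarrow> ('e \<Rightarrow> 'g) \<Rightarrow> 'e \<Rightarrow> 'e set" where
  "tangent_orbit G \<iota> \<Phi> F u = (\<lambda>\<eta>. generator \<iota> \<Phi> \<eta> u) ` isotropy_algebra G \<iota> (F u)"

definition lagrangian ::
  "('e \<Rightarrow> real) \<Rightarrow> ('e \<Rightarrow> 'g::real_inner) \<Rightarrow> 'g \<Rightarrow> 'e \<Rightarrow> real" where
  "lagrangian H F \<xi> u = H u - \<xi> \<bullet> F u"

end

theory Submission
  imports Defs
begin

text \<open>
  Put \<open>B = D\<^sup>2\<L>\<^sub>\<xi>\<close> at \<open>u\<^sub>\<xi>\<close>, let \<open>A\<close> be the self-adjoint operator of \<open>B\<close>, and let \<open>T\<close> be the derivative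
  of the branch \<open>\<zeta> \<mapsto> u\<^sub>\<zeta>\<close> at \<open>\<xi>\<close>. Differentiating the critical point equation along the branch gives
  \<open>B (T \<eta>) w = \<eta> \<bullet> DF w\<close>, so the tangent space of the level set is the \<open>B\<close>-orthogonal complement
  \<open>Z\<close> of the range of \<open>T\<close>. Since \<open>DW = - F\<close> along the branch, \<open>D\<^sup>2W\<close> is minus the pull-back of \<open>B\<close>
  under \<open>T\<close>. Non-degeneracy of \<open>D\<^sup>2W\<close> therefore makes \<open>T\<close> injective and \<open>B\<close> non-degenerate on its
  range.

  \<open>T\<close> carries a positive definite subspace of \<open>D\<^sup>2W\<close> to a negative definite subspace of \<open>B\<close>, of
  the same dimension and \<open>B\<close>-orthogonal to \<open>Z\<close>. A negative direction of \<open>B\<close> in \<open>Z\<close> would raise that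
  dimension by one, against the equality of the indices (\<open>positive_index_less_morse_index\<close>). So
  \<open>B \<ge> 0\<close> on \<open>Z\<close>, and it remains to turn this into a uniform bound on \<open>Z \<inter> (Ker A)\<^sup>\<bottom>\<close>.

  A spectral gap \<open>(0, c)\<close> of \<open>A\<close> means \<open>c \<langle>A x, x\<rangle> \<le> \<parallel>A x\<parallel>\<^sup>2\<close> for all \<open>x\<close>
  (\<open>spectral_gap_inequality\<close>). From this inequality and \<open>B \<ge> 0\<close> on \<open>Z\<close> the lemma
  \<open>form_coercive\<close> derives a Garding inequality \<open>B(x,x) \<ge> c \<parallel>x\<parallel>\<^sup>2 - C \<parallel>S x\<parallel>\<^sup>2\<close> on
  \<open>(Ker A)\<^sup>\<bottom>\<close> with \<open>S\<close> of finite rank. Along a minimising sequence of unit vectors in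
  \<open>Z \<inter> (Ker A)\<^sup>\<bottom>\<close> the values of \<open>S\<close> have a convergent subsequence. If the infimum of \<open>B\<close> were \<open>0\<close>, the
  inequality would make the corresponding vectors converge in norm, and the limit would be a unit
  vector of \<open>Z\<close> on which the nonnegative form vanishes, hence a vector of \<open>Ker A\<close> orthogonal to
  \<open>Ker A\<close>.
\<close>

section \<open>Projections and representing operators in Hilbert space\<close>

text \<open>By the parallelogram law a sequence in \<open>M\<close> that minimises the distance to \<open>x\<close> is a Cauchy
  sequence. Minimality of its limit \<open>m\<close> along the lines through \<open>m\<close> in \<open>M\<close> is orthogonality.\<close>

lemma hilbert_projection:
  fixes M :: "'e::{real_inner,banach} set"
  assumes "closed M" and "subspace M"
  obtains m where "m \<in> M" and "\<And>y. y \<in> M \<Longrightarrow> (x - m) \<bullet> y = 0"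
proof -
  define d where "d = Inf ((\<lambda>m. (norm (x - m))\<^sup>2) ` M)"
  have bdd: "bdd_below ((\<lambda>m. (norm (x - m))\<^sup>2) ` M)"
    by (rule bdd_belowI[of _ 0]) auto
  have ne: "M \<noteq> {}" using assms(2) subspace_0 by blast
  have d_le: "d \<le> (norm (x - m))\<^sup>2" if "m \<in> M" for m
    unfolding d_def using that bdd by (intro cInf_lower) auto
  have "\<exists>m\<in>M. (norm (x - m))\<^sup>2 < d + inverse (real (Suc n))" for n
  proof -
    have "d < d + inverse (real (Suc n))" by simp
    then obtain z where "z \<in> (\<lambda>m. (norm (x - m))\<^sup>2) ` M" "z < d + inverse (real (Suc n))"
      unfolding d_def using cInf_lessD[of "(\<lambda>m. (norm (x - m))\<^sup>2) ` M"] ne by blast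
    then show ?thesis by auto
  qed
  then obtain s where sM: "\<And>n. s n \<in> M"
    and s: "\<And>n. (norm (x - s n))\<^sup>2 < d + inverse (real (Suc n))" by metis
  have close: "(norm (s i - s j))\<^sup>2 \<le> 2 * inverse (real (Suc i)) + 2 * inverse (real (Suc j))" for i j
  proof -
    have "(1/2) *\<^sub>R (s i + s j) \<in> M"
      using sM assms(2) by (intro subspace_scale subspace_add)
    then have "d \<le> (norm (x - (1/2) *\<^sub>R (s i + s j)))\<^sup>2" by (rule d_le)
    moreover have "(norm (s i - s j))\<^sup>2 = 2 * (norm (x - s i))\<^sup>2 + 2 * (norm (x - s j))\<^sup>2
        - 4 * (norm (x - (1/2) *\<^sub>R (s i + s j)))\<^sup>2"
      by (simp add: power2_norm_eq_inner inner_diff_left inner_diff_right inner_add_left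
          inner_add_right inner_commute algebra_simps)
    ultimately show ?thesis using s[of i] s[of j] by linarith
  qed
  have "Cauchy s"
  proof (rule metric_CauchyI)
    fix e :: real assume "e > 0"
    then obtain N where N: "inverse (real (Suc N)) < e\<^sup>2 / 4"
      using reals_Archimedean[of "e\<^sup>2 / 4"] by auto
    show "\<exists>N. \<forall>m\<ge>N. \<forall>n\<ge>N. dist (s m) (s n) < e"
    proof (intro exI allI impI)
      fix i j assume "N \<le> i" "N \<le> j"
      then have "inverse (real (Suc i)) \<le> inverse (real (Suc N))"
        "inverse (real (Suc j)) \<le> inverse (real (Suc N))"
        by (auto intro!: le_imp_inverse_le)
      then have "(norm (s i - s j))\<^sup>2 < e\<^sup>2" using close[of i j] N by linarith
      then show "dist (s i) (s j) < e"
        using \<open>e > 0\<close> by (simp add: dist_norm power2_less_imp_less)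
    qed
  qed
  then obtain m where m: "s \<longlonglongrightarrow> m"
    using Cauchy_convergent convergent_def by blast
  have mM: "m \<in> M" using closed_sequentially[OF assms(1)] sM m by blast
  have "(\<lambda>n. (norm (x - s n))\<^sup>2) \<longlonglongrightarrow> (norm (x - m))\<^sup>2"
    using m by (intro tendsto_intros)
  moreover have "(\<lambda>n. d + inverse (real (Suc n))) \<longlonglongrightarrow> d + 0"
    by (intro tendsto_intros LIMSEQ_inverse_real_of_nat)
  ultimately have "(norm (x - m))\<^sup>2 \<le> d + 0"
    using s by (intro LIMSEQ_le) (auto intro: less_imp_le)
  then have md: "(norm (x - m))\<^sup>2 \<le> (norm (x - z))\<^sup>2" if "z \<in> M" for z
    using d_le[OF that] by linarith
  have "(x - m) \<bullet> y = 0" if y: "y \<in> M" for y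
  proof (cases "y = 0")
    case False
    \<comment> \<open>This \<open>t\<close> minimises the distance from \<open>x\<close> to the line through \<open>m\<close> with direction \<open>y\<close>.\<close>
    define t where "t = ((x - m) \<bullet> y) / (y \<bullet> y)"
    have "m + t *\<^sub>R y \<in> M" using assms(2) mM y by (intro subspace_add subspace_scale)
    from md[OF this] have "(norm (x - m))\<^sup>2 \<le> (norm ((x - m) - t *\<^sub>R y))\<^sup>2"
      by (simp add: algebra_simps)
    also have "\<dots> = (norm (x - m))\<^sup>2 - 2 * t * ((x - m) \<bullet> y) + t * (t * (y \<bullet> y))"
      unfolding power2_norm_eq_inner inner_diff_left[of "x - m"] inner_diff_right[of _ "x - m"]
      by (simp add: inner_commute)
    also have "\<dots> = (norm (x - m))\<^sup>2 - ((x - m) \<bullet> y)\<^sup>2 / (y \<bullet> y)"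
      using False by (simp add: t_def power2_eq_square)
    finally have "((x - m) \<bullet> y)\<^sup>2 / (y \<bullet> y) \<le> 0" by simp
    moreover have "y \<bullet> y > 0" using False by simp
    ultimately have "((x - m) \<bullet> y)\<^sup>2 \<le> 0" by (simp add: divide_le_0_iff)
    then show ?thesis by simp
  qed simp
  with mM that show thesis by blast
qed

text \<open>A vector orthogonal to the kernel of \<open>f\<close> represents \<open>f\<close> up to a factor, because the kernel is a
  hyperplane.\<close>

lemma riesz_representation:
  fixes f :: "'e::{real_inner,banach} \<Rightarrow>\<^sub>L real"
  shows "\<exists>a. \<forall>x. f x = a \<bullet> x"
proof (cases "f = 0")
  case True
  then show ?thesis by (intro exI[of _ 0]) simp
next
  case False
  then obtain x where x: "f x \<noteq> 0" by (metis blinfun_eqI zero_blinfun.rep_eq)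
  define M where "M = {y. f y = 0}"
  have "closed M" unfolding M_def by (intro closed_Collect_eq continuous_intros)
  moreover have "subspace M"
    by (auto simp: subspace_def M_def blinfun.bilinear_simps)
  ultimately obtain m where m: "m \<in> M" "\<And>y. y \<in> M \<Longrightarrow> (x - m) \<bullet> y = 0"
    using hilbert_projection by metis
  define r where "r = x - m"
  have fr: "f r = f x"
    using m(1) by (simp add: r_def M_def blinfun.bilinear_simps)
  with x have r0: "r \<bullet> r \<noteq> 0" by auto
  have "f y = ((f r / (r \<bullet> r)) *\<^sub>R r) \<bullet> y" for y
  proof -
    have "y - (f y / f r) *\<^sub>R r \<in> M"
      using x fr by (simp add: M_def blinfun.bilinear_simps)
    then have "r \<bullet> (y - (f y / f r) *\<^sub>R r) = 0"
      unfolding r_def by (rule m(2))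
    then have "r \<bullet> y = (f y / f r) * (r \<bullet> r)"
      by (simp add: inner_diff_right)
    then show ?thesis using r0 x fr by simp
  qed
  then show ?thesis by blast
qed

lemma bilinear_form_operator:
  fixes B :: "'e::{real_inner,banach} \<Rightarrow>\<^sub>L 'e \<Rightarrow>\<^sub>L real"
  shows "\<exists>!A :: 'e \<Rightarrow>\<^sub>L 'e. \<forall>v w. v \<bullet> A w = B v w"
proof (rule ex_ex1I)
  have "\<exists>a. \<forall>v. B v w = a \<bullet> v" for w
  proof -
    have "bounded_linear (\<lambda>v. B v w)"
      by (intro bounded_linear_intros)
    then show ?thesis
      using riesz_representation[of "Blinfun (\<lambda>v. B v w)"]
      by (simp add: bounded_linear_Blinfun_apply)
  qed
  then obtain a where a: "\<And>w v. B v w = v \<bullet> a w"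
    by (metis inner_commute)
  have "bounded_linear a"
  proof (rule bounded_linear_intro[where K = "norm B"])
    show "a (x + y) = a x + a y" for x y
      by (rule vector_eq_rdot[THEN iffD1], intro allI)
         (metis a blinfun.add_right inner_add_right inner_commute)
    show "a (r *\<^sub>R x) = r *\<^sub>R a x" for r x
      by (rule vector_eq_rdot[THEN iffD1], intro allI)
         (metis a blinfun.scaleR_right inner_scaleR_right inner_commute real_scaleR_def)
    show "norm (a x) \<le> norm x * norm B" for x
    proof (cases "a x = 0")
      case False
      have "norm (a x) * norm (a x) = B (a x) x"
        by (simp add: a power2_norm_eq_inner[symmetric] power2_eq_square[symmetric])
      also have "\<dots> \<le> norm (B (a x)) * norm x"
        using norm_blinfun[of "B (a x)" x] by simp
      also have "\<dots> \<le> (norm B * norm (a x)) * norm x"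
        by (intro mult_right_mono norm_blinfun) simp
      finally show ?thesis using False by (simp add: mult.commute mult.left_commute)
    qed simp
  qed
  then have "\<forall>v w. v \<bullet> blinfun_apply (Blinfun a) w = B v w"
    by (simp add: a bounded_linear_Blinfun_apply)
  then show "\<exists>A :: 'e \<Rightarrow>\<^sub>L 'e. \<forall>v w. v \<bullet> A w = B v w"
    by blast
next
  fix A C :: "'e \<Rightarrow>\<^sub>L 'e"
  assume "\<forall>v w. v \<bullet> A w = B v w"
    and "\<forall>v w. v \<bullet> C w = B v w"
  then have "\<forall>v. v \<bullet> A w = v \<bullet> C w" for w by simp
  then show "A = C" using vector_eq_ldot by (intro blinfun_eqI) blast
qed

lemma closure_of_subspace:
  fixes M :: "'a::real_normed_vector set"
  assumes "subspace M"
  shows "subspace (closure M)"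
proof (rule subspaceI)
  show "0 \<in> closure M" using assms subspace_0 closure_subset by blast
next
  fix x y assume "x \<in> closure M" "y \<in> closure M"
  then obtain s t where "\<And>n. s n \<in> M" "s \<longlonglongrightarrow> x" "\<And>n. t n \<in> M" "t \<longlonglongrightarrow> y"
    unfolding closure_sequential by blast
  then show "x + y \<in> closure M"
    unfolding closure_sequential
    using assms by (intro exI[of _ "\<lambda>n. s n + t n"]) (auto intro: subspace_add tendsto_add)
next
  fix c x assume "x \<in> closure M"
  then obtain s where "\<And>n. s n \<in> M" "s \<longlonglongrightarrow> x"
    unfolding closure_sequential by blast
  then show "c *\<^sub>R x \<in> closure M"
    unfolding closure_sequential
    using assms by (intro exI[of _ "\<lambda>n. c *\<^sub>R s n"]) (auto intro: subspace_scale tendsto_scaleR)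
qed

text \<open>The residual \<open>r\<close> of the projection of \<open>x\<close> to the closure of the range is orthogonal to the
  range, hence lies in the kernel by self-adjointness, hence is orthogonal to \<open>x\<close> and to \<open>x - r\<close>.\<close>

lemma selfadjoint_range_dense:
  fixes A :: "'e::{real_inner,banach} \<Rightarrow>\<^sub>L 'e"
  assumes sa: "\<And>x y. A x \<bullet> y = x \<bullet> A y"
    and x: "\<And>k. A k = 0 \<Longrightarrow> k \<bullet> x = 0"
  shows "x \<in> closure (range A)"
proof -
  have "subspace (range A)"
    by (intro linear_subspace_image) (auto intro: bounded_linear.linear blinfun.bounded_linear_right)
  then have "subspace (closure (range A))" by (rule closure_of_subspace)
  then obtain m where m: "m \<in> closure (range A)"
    "\<And>y. y \<in> closure (range A) \<Longrightarrow> (x - m) \<bullet> y = 0"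
    using hilbert_projection[OF closed_closure] by metis
  have "A (x - m) \<bullet> A (x - m) = 0"
    unfolding sa by (rule m(2)) (auto intro: closure_subset[THEN subsetD])
  then have "(x - m) \<bullet> x = 0" by (intro x) simp
  moreover have "(x - m) \<bullet> m = 0" using m by blast
  ultimately have "(x - m) \<bullet> (x - m) = 0" by (simp add: inner_diff_right[of "x - m"])
  then show ?thesis using m(1) by simp
qed

text \<open>The description defining the operator of a Hessian denotes something only because the
  representing operator exists and is unique.\<close>

lemma hessian_op_works:
  fixes f :: "'e::{real_inner,banach} \<Rightarrow> real"
  shows "v \<bullet> hessian_op f x w = hessian f x v w"
  using theI'[OF bilinear_form_operator[of "fderiv (fderiv f) x"]]
  by (simp add: hessian_op_def hessian_def)

section \<open>The inequality given by a spectral gap\<close>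

lemma positive_spectrum_gap:
  assumes "Inf (ereal ` (\<sigma> \<inter> {0<..})) > 0"
  obtains c where "0 < c" and "\<And>s. 0 < s \<Longrightarrow> s < c \<Longrightarrow> s \<notin> \<sigma>"
proof -
  obtain c where c: "ereal 0 < ereal c" "ereal c < Inf (ereal ` (\<sigma> \<inter> {0<..}))"
    using ereal_dense2[of 0 "Inf (ereal ` (\<sigma> \<inter> {0<..}))"] assms by (auto simp: zero_ereal_def)
  show thesis
  proof
    show "0 < c" using c by simp
    show "s \<notin> \<sigma>" if "0 < s" "s < c" for s
    proof
      assume "s \<in> \<sigma>"
      then have "Inf (ereal ` (\<sigma> \<inter> {0<..})) \<le> ereal s" using that by (intro Inf_lower) auto
      then show False using c that by (metis ereal_less_eq(3) leD less_le_trans order.strict_implies_order)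
    qed
  qed
qed

text \<open>The subspace \<open>S\<close> is there for forms that are indefinite on the whole space, such as the Hessian of
  a Lagrangian.\<close>

lemma psd_Cauchy_Schwarz:
  fixes A :: "'e::real_inner \<Rightarrow>\<^sub>L 'e"
  assumes "subspace S"
    and sa: "\<And>x y. A x \<bullet> y = x \<bullet> A y"
    and psd: "\<And>x. x \<in> S \<Longrightarrow> 0 \<le> x \<bullet> A x"
    and x: "x \<in> S" and y: "y \<in> S"
  shows "(x \<bullet> A y)\<^sup>2 \<le> (x \<bullet> A x) * (y \<bullet> A y)"
proof -
  have quad: "0 \<le> x \<bullet> A x + 2 * t * (x \<bullet> A y)
      + t * (t * (y \<bullet> A y))" for t
  proof -
    have "x + t *\<^sub>R y \<in> S" using assms by (intro subspace_add subspace_scale)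
    from psd[OF this] have "0 \<le> x \<bullet> A x + t * (x \<bullet> A y)
       + t * (y \<bullet> A x) + t * (t * (y \<bullet> A y))"
      by (simp add: blinfun.bilinear_simps inner_add_left inner_add_right algebra_simps)
    moreover have "y \<bullet> A x = x \<bullet> A y"
      by (metis sa inner_commute)
    ultimately show ?thesis by simp
  qed
  define a b c where "a = x \<bullet> A x" and "b = x \<bullet> A y"
    and "c = y \<bullet> A y"
  have q: "0 \<le> a + 2 * t * b + t * (t * c)" for t using quad by (simp add: a_def b_def c_def)
  have "b\<^sup>2 \<le> a * c"
  proof (cases "c = 0")
    case True
    have "b = 0"
    proof (rule ccontr)
      assume "b \<noteq> 0"
      \<comment> \<open>For \<open>c = 0\<close> the quadratic polynomial is affine in \<open>t\<close>; at this \<open>t\<close> it would take the value \<open>-1\<close>.\<close>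
      then have "a + 2 * (- (a + 1) / (2 * b)) * b = - 1" by (simp add: field_simps)
      then show False using q[of "- (a + 1) / (2 * b)"] True by simp
    qed
    then show ?thesis using True by simp
  next
    case False
    then have "c > 0" using psd[OF y] by (simp add: c_def)
    have "a + 2 * (- b / c) * b + (- b / c) * ((- b / c) * c) = (a * c - b\<^sup>2) / c"
      using False by (simp add: field_simps power2_eq_square)
    then show ?thesis using q[of "- b / c"] \<open>c > 0\<close> by (simp add: zero_le_divide_iff)
  qed
  then show ?thesis by (simp add: a_def b_def c_def)
qed

text \<open>For \<open>M \<ge> 0\<close> this is \<open>M\<^sup>2 \<le> \<parallel>M\<parallel> M\<close>; it follows from the Cauchy-Schwarz inequality for the form
  of \<open>M\<close> at the vectors \<open>M x\<close> and \<open>x\<close>. It says that a vector on which the form is small is an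
  approximate kernel vector of \<open>M\<close>.\<close>

lemma psd_norm_le:
  fixes M :: "'e::real_inner \<Rightarrow>\<^sub>L 'e"
  assumes sa: "\<And>x y. M x \<bullet> y = x \<bullet> M y" and psd: "\<And>x. 0 \<le> x \<bullet> M x"
  shows "(norm (M x))\<^sup>2 \<le> norm M * (x \<bullet> M x)"
proof (cases "M x = 0")
  case True
  then show ?thesis by simp
next
  case False
  define r where "r = (norm (M x))\<^sup>2"
  have r: "r > 0" using False by (simp add: r_def)
  have "r\<^sup>2 = (M x \<bullet> M x)\<^sup>2" by (simp add: r_def power2_norm_eq_inner)
  also have "\<dots> \<le> (M x \<bullet> M (M x)) * (x \<bullet> M x)"
    using psd_Cauchy_Schwarz[OF subspace_UNIV sa psd UNIV_I UNIV_I, of "M x" x] .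
  also have "\<dots> \<le> (norm M * r) * (x \<bullet> M x)"
  proof (rule mult_right_mono[OF _ psd])
    have "M x \<bullet> M (M x) \<le> norm (M x) * norm (M (M x))" by (rule norm_cauchy_schwarz)
    also have "\<dots> \<le> norm (M x) * (norm M * norm (M x))"
      by (intro mult_left_mono norm_blinfun) simp
    finally show "M x \<bullet> M (M x) \<le> norm M * r"
      by (simp add: r_def power2_eq_square ac_simps)
  qed
  finally have "r * r \<le> (norm M * (x \<bullet> M x)) * r" by (simp add: power2_eq_square ac_simps)
  then show ?thesis using r mult_le_cancel_right_pos by (metis r_def)
qed

lemma not_in_spectrum_bounded_below:
  fixes A :: "'e::real_normed_vector \<Rightarrow>\<^sub>L 'e"
  assumes "s \<notin> spectrum A"
  obtains k where "k \<ge> 0" and "\<And>x. norm x \<le> k * norm (A x - s *\<^sub>R x)"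
proof -
  obtain R where R: "R o\<^sub>L (A - s *\<^sub>R id_blinfun) = id_blinfun"
    using assms by (auto simp: spectrum_def)
  have "norm x \<le> norm R * norm (A x - s *\<^sub>R x)" for x
  proof -
    have "x = R (A x - s *\<^sub>R x)"
      using arg_cong[OF R, of "\<lambda>L. blinfun_apply L x"] by (simp add: blinfun.bilinear_simps)
    then show ?thesis by (metis norm_blinfun)
  qed
  then show thesis using that[of "norm R"] by simp
qed

text \<open>With \<open>S = A - c/2\<close> the claim is \<open>\<parallel>S x\<parallel> \<ge> c/2 \<parallel>x\<parallel>\<close>, the bound on the resolvent at the midpoint of
  the gap. Let \<open>a\<close> be the infimum of \<open>\<parallel>S y\<parallel>\<close> over unit vectors and suppose \<open>a < c/2\<close>. Then
  \<open>M = S\<^sup>2 - a\<^sup>2\<close> is nonnegative and its form comes arbitrarily close to \<open>0\<close> on unit vectors, so \<open>M\<close> is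
  not bounded below. But \<open>M = (S - a) (S + a)\<close> is a product of two operators \<open>A - s\<close> with \<open>s\<close> in the
  gap, each of them invertible.\<close>

lemma spectral_gap_inequality:
  fixes A :: "'e::real_inner \<Rightarrow>\<^sub>L 'e"
  assumes sa: "\<And>x y. A x \<bullet> y = x \<bullet> A y"
    and gap: "\<And>s. 0 < s \<Longrightarrow> s < c \<Longrightarrow> s \<notin> spectrum A"
    and c: "0 < c"
  shows "c * (x \<bullet> A x) \<le> (norm (A x))\<^sup>2"
proof (cases "x = 0")
  case True
  then show ?thesis by simp
next
  case False
  define S where "S = A - (c / 2) *\<^sub>R id_blinfun"
  have S: "S y = A y - (c / 2) *\<^sub>R y" for y
    by (simp add: S_def blinfun.bilinear_simps)
  have saS: "S y \<bullet> z = y \<bullet> S z" for y z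
    by (simp add: S sa inner_diff_left inner_diff_right)
  define Q where "Q = (\<lambda>y. (norm (S y))\<^sup>2) ` {y. norm y = 1}"
  define q where "q = Inf Q"
  have bdd: "bdd_below Q" by (rule bdd_belowI[of _ 0]) (auto simp: Q_def)
  have ne: "Q \<noteq> {}"
    using False by (auto simp: Q_def intro!: exI[of _ "x /\<^sub>R norm x"])
  have q0: "0 \<le> q" unfolding q_def by (rule cInf_greatest[OF ne]) (auto simp: Q_def)
  have q_le: "q * (norm y)\<^sup>2 \<le> (norm (S y))\<^sup>2" for y
  proof (cases "y = 0")
    case False
    have "(norm (S (y /\<^sub>R norm y)))\<^sup>2 \<in> Q" using False by (auto simp: Q_def)
    then have "q \<le> (norm (S (y /\<^sub>R norm y)))\<^sup>2"
      unfolding q_def by (rule cInf_lower[OF _ bdd])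
    also have "\<dots> = (norm (S y))\<^sup>2 / (norm y)\<^sup>2"
      by (simp add: blinfun.scaleR_right power_mult_distrib power_divide divide_inverse power_inverse mult.commute)
    finally show ?thesis using False by (simp add: field_simps)
  qed simp
  have "(c / 2)\<^sup>2 \<le> q"
  proof (rule ccontr)
    assume "\<not> (c / 2)\<^sup>2 \<le> q"
    define a where "a = sqrt q"
    have a2: "a * a = q" and a0: "0 \<le> a" using q0 by (auto simp: a_def)
    have "a < c / 2"
      using \<open>\<not> (c / 2)\<^sup>2 \<le> q\<close> c a0 a2 by (metis linorder_not_le power2_eq_square power_mono half_gt_zero less_imp_le)
    then have "c / 2 + a \<notin> spectrum A" "c / 2 - a \<notin> spectrum A"
      using a0 c gap[of "c / 2 + a"] gap[of "c / 2 - a"] by auto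
    then obtain k l where k: "k \<ge> 0" "\<And>y. norm y \<le> k * norm (A y - (c / 2 + a) *\<^sub>R y)"
      and l: "l \<ge> 0" "\<And>y. norm y \<le> l * norm (A y - (c / 2 - a) *\<^sub>R y)"
      by (meson not_in_spectrum_bounded_below)
    define M where "M = (S o\<^sub>L S) - q *\<^sub>R id_blinfun"
    have M: "M y = S (S y) - q *\<^sub>R y" for y
      by (simp add: M_def blinfun.bilinear_simps)
    have yM: "y \<bullet> M y = (norm (S y))\<^sup>2 - q * (norm y)\<^sup>2" for y
      by (simp add: M inner_diff_right saS[symmetric] power2_norm_eq_inner)
    have fac: "M y = A (A y - (c / 2 - a) *\<^sub>R y) - (c / 2 + a) *\<^sub>R (A y - (c / 2 - a) *\<^sub>R y)" for y
      by (simp add: M S blinfun.bilinear_simps a2[symmetric] algebra_simps)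
    have inv: "norm y \<le> (l * k) * norm (M y)" for y
    proof -
      have "norm y \<le> l * norm (A y - (c / 2 - a) *\<^sub>R y)" by (rule l)
      also have "\<dots> \<le> l * (k * norm (M y))"
        unfolding fac by (intro mult_left_mono k l)
      finally show ?thesis by (simp add: ac_simps)
    qed
    have saM: "M y \<bullet> z = y \<bullet> M z" for y z
      by (simp add: M saS inner_diff_left inner_diff_right)
    define K where "K = (l * k)\<^sup>2 * norm M + 1"
    have K: "K > 0" by (simp add: K_def add_nonneg_pos)
    \<comment> \<open>Bounded inverses of the factors push all values of \<open>\<parallel>S y\<parallel>\<^sup>2\<close> on the unit sphere away from
        their infimum \<open>q\<close>.\<close>
    have "q + 1 / K \<le> z" if zQ: "z \<in> Q" for z
    proof -
      obtain y where y: "norm y = 1" "z = (norm (S y))\<^sup>2" using zQ by (auto simp: Q_def)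
      have psd: "0 \<le> y \<bullet> M y" for y using q_le by (simp add: yM)
      have "1 \<le> ((l * k) * norm (M y))\<^sup>2" using inv[of y] y(1) by (simp add: one_le_power)
      also have "\<dots> \<le> (l * k)\<^sup>2 * (norm M * (y \<bullet> M y))"
        unfolding power_mult_distrib[of "l * k"]
        by (intro mult_left_mono psd_norm_le saM psd) simp
      also have "\<dots> \<le> K * (y \<bullet> M y)"
        using psd[of y] by (simp add: K_def algebra_simps)
      also have "\<dots> = K * (z - q)" by (simp add: yM y)
      finally show ?thesis using K by (simp add: field_simps)
    qed
    then have "q + 1 / K \<le> q" unfolding q_def by (intro cInf_greatest[OF ne])
    then show False using K by simp
  qed
  then have "(c / 2)\<^sup>2 * (norm x)\<^sup>2 \<le> (norm (S x))\<^sup>2"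
    using q_le[of x] by (meson mult_right_mono order_trans zero_le_power2)
  also have "(norm (S x))\<^sup>2 = (norm (A x))\<^sup>2 - c * (x \<bullet> A x) + (c / 2)\<^sup>2 * (norm x)\<^sup>2"
    unfolding S power2_norm_eq_inner
    by (simp add: inner_diff_left inner_diff_right inner_commute power2_eq_square algebra_simps)
  finally show ?thesis by simp
qed

section \<open>Coercivity from nonnegativity on a complement of finite codimension\<close>

text \<open>Since the domain of \<open>T\<close> is Euclidean, the adjoint is a finite sum over an orthonormal basis, also
  when \<open>T\<close> takes values in an infinite-dimensional space.\<close>

lemma euclidean_adjoint:
  fixes T :: "'c::euclidean_space \<Rightarrow> 'e::real_inner"
  assumes "linear T"
  obtains P where "bounded_linear P" and "\<And>k w. k \<bullet> P w = T k \<bullet> w"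
proof
  show "bounded_linear (\<lambda>w. \<Sum>b\<in>Basis. (T b \<bullet> w) *\<^sub>R b)"
    by (intro bounded_linear_intros)
  show "k \<bullet> (\<Sum>b\<in>Basis. (T b \<bullet> w) *\<^sub>R b) = T k \<bullet> w" for k w
  proof -
    have "T k = T (\<Sum>b\<in>Basis. (k \<bullet> b) *\<^sub>R b)" by (simp add: euclidean_representation)
    also have "\<dots> = (\<Sum>b\<in>Basis. (k \<bullet> b) *\<^sub>R T b)"
      using assms by (simp add: linear_sum linear_scale)
    finally show ?thesis by (simp add: inner_sum_left inner_sum_right mult.commute)
  qed
qed

text \<open>Every \<open>w\<close> is the sum of \<open>Y (P w)\<close>, in the range of \<open>T\<close>, and a vector that is orthogonal to that range
  with respect to the form of \<open>A\<close>. The point is that the first part is controlled by \<open>P w\<close>, that is, by the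
  pairings of \<open>w\<close> with the range of \<open>T\<close>. It is found by solving \<open>N k = P w\<close> for the Gram operator
  \<open>N = P \<circ> T\<close>, which is self-adjoint on a Euclidean space, so that its range is the orthogonal
  complement of its kernel. Non-degeneracy of the form on the range of \<open>T\<close> says that the kernel of
  \<open>N\<close> is the kernel of \<open>T\<close>, and \<open>P w\<close> is orthogonal to that.\<close>

lemma form_orthogonal_splitting:
  fixes A :: "'e::{real_inner,banach} \<Rightarrow>\<^sub>L 'e" and T :: "'c::euclidean_space \<Rightarrow> 'e"
  assumes sa: "\<And>x y. A x \<bullet> y = x \<bullet> A y"
    and T: "linear T"
    and nondeg: "\<And>k. (\<And>l. T l \<bullet> A (T k) = 0) \<Longrightarrow> T k = 0"
    and P: "bounded_linear P" and TP: "\<And>k w. k \<bullet> P w = T k \<bullet> A w"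
  obtains Y where "bounded_linear Y" "range Y \<subseteq> range T" "\<And>w k. T k \<bullet> A (w - Y (P w)) = 0"
proof -
  have blT: "bounded_linear T" using T by (simp add: linear_conv_bounded_linear)
  interpret P: bounded_linear P by fact
  define N where "N = Blinfun (\<lambda>k. P (T k))"
  have N: "N k = P (T k)" for k
    unfolding N_def
    by (subst bounded_linear_Blinfun_apply) (auto intro: bounded_linear_compose[OF P blT])
  have saN: "N k \<bullet> l = k \<bullet> N l" for k l
    by (metis N TP inner_commute sa)
  have linN: "linear N" by (intro bounded_linear.linear blinfun.bounded_linear_right)
  obtain g where g: "linear g" "\<And>p. p \<in> range N \<Longrightarrow> N (g p) = p"
    using linear_exists_right_inverse_on[OF linN subspace_UNIV] by auto
  have in_range: "P w \<in> range N" for w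
  proof -
    have "P w \<in> closure (range N)"
    proof (rule selfadjoint_range_dense[OF saN])
      fix k assume "N k = 0"
      then have "T l \<bullet> A (T k) = 0" for l by (metis N TP inner_zero_right)
      then have "T k = 0" by (rule nondeg)
      then show "k \<bullet> P w = 0" by (simp add: TP)
    qed
    moreover have "closed (range N)"
      by (intro closed_subspace linear_subspace_image linN subspace_UNIV)
    ultimately show ?thesis by simp
  qed
  show thesis
  proof
    show "bounded_linear (\<lambda>p. T (g p))"
      using g(1) by (intro bounded_linear_compose[OF blT]) (simp add: linear_conv_bounded_linear)
    show "range (\<lambda>p. T (g p)) \<subseteq> range T" by auto
    show "T k \<bullet> A (w - T (g (P w))) = 0" for w k
      using g(2)[OF in_range[of w]] by (simp add: TP[symmetric] P.diff N)
  qed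
qed

text \<open>Let \<open>Z\<close> be the orthogonal complement of the range of \<open>T\<close> with respect to the form of \<open>A\<close>. By the
  splitting above the form is bounded below by \<open>- C \<parallel>P w\<parallel>\<^sup>2\<close> on the whole space. Apply this to
  \<open>w = (A - c) z\<close>. By the identity
  \<open>A\<^sup>3 - c A\<^sup>2 = (A - c) A (A - c) + c (A\<^sup>2 - c A)\<close> and the gap inequality \<open>A\<^sup>2 \<ge> c A\<close>, the vector
  \<open>x = A z\<close> satisfies \<open>\<langle>A x, x\<rangle> - c \<parallel>x\<parallel>\<^sup>2 \<ge> - C \<parallel>P w\<parallel>\<^sup>2\<close>. Since \<open>A\<close> commutes with \<open>A - c\<close>, the
  pairings of \<open>w\<close> with the range of \<open>T\<close> depend on \<open>x\<close> only: \<open>P w = S x\<close> with \<open>S\<close> bounded and of finite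
  rank. The resulting Garding inequality is stable under limits and so extends from the range of
  \<open>A\<close> to its closure, the orthogonal complement of the kernel. The rest is the compactness
  argument of the introduction.\<close>

lemma form_coercive:
  fixes A :: "'e::{real_inner,banach} \<Rightarrow>\<^sub>L 'e" and T :: "'c::euclidean_space \<Rightarrow> 'e"
  assumes sa: "\<And>x y. A x \<bullet> y = x \<bullet> A y"
    and c: "0 < c" and gap: "\<And>x. c * (x \<bullet> A x) \<le> (norm (A x))\<^sup>2"
    and T: "linear T"
    and nondeg: "\<And>k. (\<And>l. T l \<bullet> A (T k) = 0) \<Longrightarrow> T k = 0"
    and nonneg: "\<And>z. (\<And>k. T k \<bullet> A z = 0) \<Longrightarrow> 0 \<le> z \<bullet> A z"
  shows "\<exists>\<delta>>0. \<forall>v. (\<forall>k. T k \<bullet> A v = 0) \<longrightarrow> (\<forall>k. A k = 0 \<longrightarrow> k \<bullet> v = 0)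
           \<longrightarrow> \<delta> * (norm v)\<^sup>2 \<le> v \<bullet> A v"
proof -
  have blT: "bounded_linear T" using T by (simp add: linear_conv_bounded_linear)
  have lin1: "linear (\<lambda>k. A (T k))" and lin2: "linear (\<lambda>k. A (T k) - c *\<^sub>R T k)"
    by (simp_all add: linear_iff linear_add[OF T] linear_scale[OF T] blinfun.bilinear_simps
        algebra_simps)
  obtain P where P: "bounded_linear P" and P1: "\<And>k w. k \<bullet> P w = A (T k) \<bullet> w"
    using euclidean_adjoint[OF lin1] by blast
  have TP: "k \<bullet> P w = T k \<bullet> A w" for k w by (simp add: P1 sa)
  obtain S where S: "bounded_linear S" and TS: "\<And>k w. k \<bullet> S w = (A (T k) - c *\<^sub>R T k) \<bullet> w"
    using euclidean_adjoint[OF lin2] by blast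
  interpret S: bounded_linear S by fact
  obtain Y where Y: "bounded_linear Y" "range Y \<subseteq> range T"
    and WY: "\<And>w k. T k \<bullet> A (w - Y (P w)) = 0"
    using form_orthogonal_splitting[OF sa T nondeg P TP] by blast
  obtain K where K: "\<And>p. norm (Y p) \<le> norm p * K" using bounded_linear.bounded[OF Y(1)] by blast
  define C where "C = norm A * K\<^sup>2"
  have C0: "0 \<le> C" by (simp add: C_def)
  have low: "- C * (norm (P w))\<^sup>2 \<le> w \<bullet> A w" for w
  proof -
    define y where "y = Y (P w)"
    define z where "z = w - y"
    have zT: "T k \<bullet> A z = 0" for k unfolding z_def y_def by (rule WY)
    obtain k where k: "y = T k" using Y(2) by (auto simp: y_def)
    have yz: "y \<bullet> A z = 0" using zT k by simp
    then have "z \<bullet> A y = 0" by (metis sa inner_commute)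
    with yz have "w \<bullet> A w = y \<bullet> A y + z \<bullet> A z"
      by (simp add: z_def blinfun.bilinear_simps inner_diff_left inner_diff_right)
    then have "y \<bullet> A y \<le> w \<bullet> A w" using nonneg[of z] zT by simp
    moreover have "\<bar>y \<bullet> A y\<bar> \<le> C * (norm (P w))\<^sup>2"
    proof -
      have "\<bar>y \<bullet> A y\<bar> \<le> norm y * norm (A y)" by (rule Cauchy_Schwarz_ineq2)
      also have "\<dots> \<le> norm y * (norm A * norm y)" by (intro mult_left_mono norm_blinfun) simp
      also have "\<dots> = norm A * (norm y)\<^sup>2" by (simp add: power2_eq_square)
      also have "\<dots> \<le> norm A * (norm (P w) * K)\<^sup>2"
        using K[of "P w"] by (intro mult_left_mono power_mono) (auto simp: y_def)
      finally show ?thesis by (simp add: C_def power_mult_distrib ac_simps)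
    qed
    ultimately show ?thesis by linarith
  qed
  have garding_range: "c * (norm x)\<^sup>2 - C * (norm (S x))\<^sup>2 \<le> x \<bullet> A x" if xr: "x \<in> range A" for x
  proof -
    obtain z where z: "x = A z" using xr by blast
    define w where "w = A z - c *\<^sub>R z"
    have "P w = S x"
    proof (rule vector_eq_ldot[THEN iffD1], intro allI)
      show "k \<bullet> P w = k \<bullet> S x" for k
        by (simp add: TP TS w_def z blinfun.bilinear_simps inner_diff_left inner_diff_right sa)
    qed
    moreover have "x \<bullet> A x - c * (norm x)\<^sup>2 = w \<bullet> A w + c * ((norm (A z))\<^sup>2 - c * (z \<bullet> A z))"
      by (simp add: w_def z blinfun.bilinear_simps inner_diff_left inner_diff_right sa
          power2_norm_eq_inner algebra_simps)
    moreover have "0 \<le> c * ((norm (A z))\<^sup>2 - c * (z \<bullet> A z))" using c gap[of z] by simp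
    ultimately show ?thesis using low[of w] by simp
  qed
  have garding: "c * (norm x)\<^sup>2 - C * (norm (S x))\<^sup>2 \<le> x \<bullet> A x"
    if x: "\<And>k. A k = 0 \<Longrightarrow> k \<bullet> x = 0" for x
  proof -
    have "x \<in> closure (range A)" by (rule selfadjoint_range_dense[OF sa x])
    then obtain s where s: "\<And>n. s n \<in> range A" "s \<longlonglongrightarrow> x" unfolding closure_sequential by blast
    show ?thesis
    proof (rule LIMSEQ_le)
      show "(\<lambda>n. c * (norm (s n))\<^sup>2 - C * (norm (S (s n)))\<^sup>2) \<longlonglongrightarrow> c * (norm x)\<^sup>2 - C * (norm (S x))\<^sup>2"
        using s(2) by (intro tendsto_intros S.tendsto)
      show "(\<lambda>n. s n \<bullet> A (s n)) \<longlonglongrightarrow> x \<bullet> A x"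
        using s(2) by (intro tendsto_intros)
    qed (use garding_range s(1) in blast)
  qed
  define X where "X = {v. (\<forall>k. T k \<bullet> A v = 0) \<and> (\<forall>k. A k = 0 \<longrightarrow> k \<bullet> v = 0)}"
  have subX: "subspace X"
    by (auto simp: subspace_def X_def blinfun.bilinear_simps inner_add_right)
  have "\<exists>\<delta>>0. \<forall>v\<in>X. \<delta> * (norm v)\<^sup>2 \<le> v \<bullet> A v"
  proof (rule ccontr)
    assume neg: "\<not> ?thesis"
    have "\<exists>x\<in>X. norm x = 1 \<and> x \<bullet> A x < inverse (real (Suc n))" for n
    proof -
      have "inverse (real (Suc n)) > 0" by simp
      then obtain v where v: "v \<in> X" "\<not> inverse (real (Suc n)) * (norm v)\<^sup>2 \<le> v \<bullet> A v"
        using neg by blast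
      then have v0: "v \<noteq> 0" by auto
      have "v /\<^sub>R norm v \<in> X" using subX v(1) by (rule subspace_scale)
      moreover have "(v /\<^sub>R norm v) \<bullet> A (v /\<^sub>R norm v) = (v \<bullet> A v) / (norm v)\<^sup>2"
        by (simp add: blinfun.scaleR_right power2_eq_square field_simps)
      moreover have "(v \<bullet> A v) / (norm v)\<^sup>2 < inverse (real (Suc n))"
        using v v0 by (simp add: divide_less_eq)
      ultimately show ?thesis using v0 by (intro bexI[of _ "v /\<^sub>R norm v"]) auto
    qed
    then obtain s where s: "\<And>n. s n \<in> X" "\<And>n. norm (s n) = 1"
      "\<And>n. s n \<bullet> A (s n) < inverse (real (Suc n))" by metis
    have psdX: "0 \<le> v \<bullet> A v" if "v \<in> X" for v using that by (intro nonneg) (simp add: X_def)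
    have s_lim: "(\<lambda>n. s n \<bullet> A (s n)) \<longlonglongrightarrow> 0"
    proof (rule tendsto_sandwich[OF _ _ tendsto_const LIMSEQ_inverse_real_of_nat])
      show "\<forall>\<^sub>F n in sequentially. 0 \<le> s n \<bullet> A (s n)"
        by (intro always_eventually allI psdX s(1))
      show "\<forall>\<^sub>F n in sequentially. s n \<bullet> A (s n) \<le> inverse (real (Suc n))"
        using s(3) by (intro always_eventually allI less_imp_le)
    qed
    obtain L where L: "\<And>x. norm (S x) \<le> norm x * L" using S.bounded by blast
    have "\<forall>n. S (s n) \<in> cball 0 L" using L s(2) by (metis mem_cball_0 mult_1)
    then obtain r l where r: "strict_mono r" and l: "((\<lambda>n. S (s n)) \<circ> r) \<longlonglongrightarrow> l"
      using compact_cball[of 0 L, unfolded compact_def, rule_format, of "\<lambda>n. S (s n)"] by blast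
    define t where "t = s \<circ> r"
    have tX: "t n \<in> X" and t1: "norm (t n) = 1" for n by (auto simp: t_def s)
    have t_lim: "(\<lambda>n. t n \<bullet> A (t n)) \<longlonglongrightarrow> 0"
      using LIMSEQ_subseq_LIMSEQ[OF s_lim r] by (simp add: t_def o_def)
    have "Cauchy (\<lambda>n. S (t n))"
      using l by (intro LIMSEQ_imp_Cauchy) (simp add: t_def o_def)
    have tij: "c * (norm (t i - t j))\<^sup>2
        \<le> C * (norm (S (t i) - S (t j)))\<^sup>2 + 2 * (t i \<bullet> A (t i)) + 2 * (t j \<bullet> A (t j))" for i j
    proof -
      have m: "t i - t j \<in> X" and p: "t i + t j \<in> X"
        using subX tX by (auto intro: subspace_diff subspace_add)
      \<comment> \<open>Nonnegativity of the form at \<open>t i + t j\<close> makes the form at the difference small.\<close>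
      have "(t i - t j) \<bullet> A (t i - t j) + (t i + t j) \<bullet> A (t i + t j)
          = 2 * (t i \<bullet> A (t i)) + 2 * (t j \<bullet> A (t j))"
        by (simp add: blinfun.bilinear_simps inner_diff_left inner_diff_right inner_add_left inner_add_right)
      moreover have "c * (norm (t i - t j))\<^sup>2 - C * (norm (S (t i - t j)))\<^sup>2 \<le> (t i - t j) \<bullet> A (t i - t j)"
        using m by (intro garding) (simp add: X_def)
      ultimately show ?thesis using psdX[OF p] by (simp add: S.diff)
    qed
    have "Cauchy t"
    proof (rule metric_CauchyI)
      fix e :: real assume e: "e > 0"
      define d where "d = c * e\<^sup>2"
      have d: "d > 0" using c e by (simp add: d_def)
      define f where "f = sqrt (d / 2 / (C + 1))"
      have f: "f > 0" using d C0 by (simp add: f_def)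
      obtain N1 where N1: "\<And>i j. i \<ge> N1 \<Longrightarrow> j \<ge> N1 \<Longrightarrow> norm (S (t i) - S (t j)) < f"
        using CauchyD[OF \<open>Cauchy (\<lambda>n. S (t n))\<close> f] by blast
      obtain N2 where N2: "\<And>i. i \<ge> N2 \<Longrightarrow> norm (t i \<bullet> A (t i) - 0) < d / 8"
        using LIMSEQ_D[OF t_lim, of "d / 8"] d by auto
      show "\<exists>N. \<forall>i\<ge>N. \<forall>j\<ge>N. dist (t i) (t j) < e"
      proof (intro exI allI impI)
        fix i j assume ij: "max N1 N2 \<le> i" "max N1 N2 \<le> j"
        have "C * (norm (S (t i) - S (t j)))\<^sup>2 \<le> C * f\<^sup>2"
          using N1[of i j] ij C0 by (intro mult_left_mono power_mono) auto
        also have "C * f\<^sup>2 \<le> (C + 1) * f\<^sup>2" by (intro mult_right_mono) auto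
        also have "(C + 1) * f\<^sup>2 = (C + 1) * (d / 2 / (C + 1))" using d C0 by (simp add: f_def)
        also have "\<dots> = d / 2"
          using C0 by (intro nonzero_mult_div_cancel_left[of "C + 1" "d / 2", simplified times_divide_eq_right[symmetric]]) simp
        finally have "C * (norm (S (t i) - S (t j)))\<^sup>2 \<le> d / 2" .
        moreover have "t i \<bullet> A (t i) < d / 8" "t j \<bullet> A (t j) < d / 8"
          using N2[of i] N2[of j] ij by auto
        ultimately have "c * (norm (t i - t j))\<^sup>2 < c * e\<^sup>2"
          using tij[of i j] d by (simp add: d_def)
        then have "(norm (t i - t j))\<^sup>2 < e\<^sup>2" using c by simp
        then show "dist (t i) (t j) < e" using e by (simp add: dist_norm power2_less_imp_less)
      qed
    qed
    then obtain x where x: "t \<longlonglongrightarrow> x" using Cauchy_convergent convergent_def by blast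
    have "(\<lambda>n. norm (t n)) \<longlonglongrightarrow> norm x" using x by (intro tendsto_intros)
    then have x1: "norm x = 1" using t1 by (simp add: LIMSEQ_const_iff)
    have "(\<lambda>n. t n \<bullet> A (t n)) \<longlonglongrightarrow> x \<bullet> A x" using x by (intro tendsto_intros)
    then have Bxx: "x \<bullet> A x = 0" using t_lim LIMSEQ_unique by blast
    have "(\<lambda>n. T k \<bullet> A (t n)) \<longlonglongrightarrow> T k \<bullet> A x" for k using x by (intro tendsto_intros)
    then have xT: "T k \<bullet> A x = 0" for k
      using tX by (simp add: X_def LIMSEQ_const_iff)
    have xK: "k \<bullet> x = 0" if k: "A k = 0" for k
    proof -
      have "(\<lambda>n. k \<bullet> t n) \<longlonglongrightarrow> k \<bullet> x" using x by (intro tendsto_intros)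
      moreover have "k \<bullet> t n = 0" for n using tX[of n] k by (simp add: X_def)
      ultimately show ?thesis by (simp add: LIMSEQ_const_iff)
    qed
    \<comment> \<open>A zero of the nonnegative form on \<open>Z\<close> pairs to zero with \<open>Z\<close>, and \<open>x \<in> Z\<close> pairs to zero
        with the range of \<open>T\<close>; together these span.\<close>
    have "w \<bullet> A x = 0" for w
    proof -
      define Z where "Z = {z. \<forall>k. T k \<bullet> A z = 0}"
      have "subspace Z" by (auto simp: subspace_def Z_def blinfun.bilinear_simps inner_add_right)
      then have "((w - Y (P w)) \<bullet> A x)\<^sup>2 \<le> ((w - Y (P w)) \<bullet> A (w - Y (P w))) * (x \<bullet> A x)"
        by (rule psd_Cauchy_Schwarz[OF _ sa]) (auto simp: Z_def xT WY intro: nonneg)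
      then have "(w - Y (P w)) \<bullet> A x = 0" by (simp add: Bxx)
      moreover have "Y (P w) \<bullet> A x = 0" using Y(2) xT by (metis imageE rangeI subsetD)
      ultimately show ?thesis by (simp add: inner_diff_left)
    qed
    then have "A x = 0" by (metis inner_eq_zero_iff)
    then have "x \<bullet> x = 0" by (rule xK)
    then show False using x1 by simp
  qed
  then show ?thesis unfolding X_def by blast
qed

section \<open>Symmetry of the second derivative\<close>

text \<open>The second difference of \<open>f\<close> over the parallelogram spanned by \<open>h v\<close> and \<open>h w\<close> is, by the mean
  value theorem in the direction \<open>v\<close>, a first difference of \<open>f'\<close> in the direction \<open>w\<close>. The
  latter is compared with \<open>f''\<close> by expanding \<open>f'\<close> at both ends of it around \<open>x\<close>.\<close>

lemma symmetric_second_derivative_aux: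
  fixes f :: "'a::real_normed_vector \<Rightarrow> real" and f'' :: "'a \<Rightarrow>\<^sub>L 'a \<Rightarrow>\<^sub>L real"
  assumes f: "\<And>y. (f has_derivative blinfun_apply (f' y)) (at y)"
    and f': "(f' has_derivative blinfun_apply f'') (at x)"
    and e: "e > 0"
  shows "\<exists>r>0. \<forall>h. 0 < h \<longrightarrow> h < r \<longrightarrow>
    \<bar>f (x + h *\<^sub>R v + h *\<^sub>R w) - f (x + h *\<^sub>R v) - f (x + h *\<^sub>R w) + f x - h\<^sup>2 * f'' w v\<bar>
      \<le> e * h\<^sup>2 * ((2 * norm v + norm w) * norm v)"
proof -
  obtain d where d: "d > 0"
    and D: "\<And>y. norm (y - x) < d \<Longrightarrow> norm (f' y - f' x - f'' (y - x)) \<le> e * norm (y - x)"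
    using f' e unfolding has_derivative_at_alt by blast
  have rem: "\<bar>f' (x + k) v - f' x v - f'' k v\<bar> \<le> e * norm k * norm v" if "norm k < d" for k
  proof -
    have "\<bar>f' (x + k) v - f' x v - f'' k v\<bar> = norm ((f' (x + k) - f' x - f'' k) v)"
      by (simp add: blinfun.bilinear_simps)
    also have "\<dots> \<le> norm (f' (x + k) - f' x - f'' k) * norm v" by (rule norm_blinfun)
    also have "\<dots> \<le> e * norm k * norm v" using D[of "x + k"] that by (intro mult_right_mono) auto
    finally show ?thesis .
  qed
  define n where "n = norm v + norm w + 1"
  have n: "n > 0" by (simp add: n_def add_nonneg_pos)
  show ?thesis
  proof (intro exI[of _ "d / n"] conjI allI impI)
    show "0 < d / n" using d n by simp
    fix h assume h: "0 < h" "h < d / n"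
    then have hn: "h * norm v + h * norm w < d"
      using n by (simp add: n_def field_simps)
    define g where "g = (\<lambda>\<tau>. f (x + (\<tau> *\<^sub>R v + h *\<^sub>R w)) - f (x + \<tau> *\<^sub>R v))"
    have dg: "(g has_real_derivative (f' (x + (\<tau> *\<^sub>R v + h *\<^sub>R w)) v - f' (x + \<tau> *\<^sub>R v) v)) (at \<tau>)" for \<tau>
    proof -
      have "((\<lambda>\<tau>. f (x + (\<tau> *\<^sub>R v + k))) has_derivative (\<lambda>s. f' (x + (\<tau> *\<^sub>R v + k)) (s *\<^sub>R v))) (at \<tau>)" for k
        by (rule has_derivative_compose[OF _ f]) (auto intro!: derivative_eq_intros)
      from has_derivative_diff[OF this[of "h *\<^sub>R w"] this[of 0]]
      have "(g has_derivative (\<lambda>s. f' (x + (\<tau> *\<^sub>R v + h *\<^sub>R w)) (s *\<^sub>R v) - f' (x + \<tau> *\<^sub>R v) (s *\<^sub>R v))) (at \<tau>)"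
        by (simp add: g_def)
      moreover have "(\<lambda>s. f' (x + (\<tau> *\<^sub>R v + h *\<^sub>R w)) (s *\<^sub>R v) - f' (x + \<tau> *\<^sub>R v) (s *\<^sub>R v))
          = (*) (f' (x + (\<tau> *\<^sub>R v + h *\<^sub>R w)) v - f' (x + \<tau> *\<^sub>R v) v)"
        by (simp add: fun_eq_iff blinfun.scaleR_right algebra_simps)
      ultimately show ?thesis
        by (simp only: has_field_derivative_def)
    qed
    obtain \<tau> where \<tau>: "0 < \<tau>" "\<tau> < h"
      and mv: "g h - g 0 = (h - 0) * (f' (x + (\<tau> *\<^sub>R v + h *\<^sub>R w)) v - f' (x + \<tau> *\<^sub>R v) v)"
      using MVT2[OF h(1), of g "\<lambda>\<tau>. f' (x + (\<tau> *\<^sub>R v + h *\<^sub>R w)) v - f' (x + \<tau> *\<^sub>R v) v"] dg by blast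
    have \<tau>v: "norm (\<tau> *\<^sub>R v) \<le> h * norm v" using \<tau> by (simp add: mult_right_mono)
    have \<tau>w: "norm (\<tau> *\<^sub>R v + h *\<^sub>R w) \<le> h * norm v + h * norm w"
      using norm_triangle_ineq[of "\<tau> *\<^sub>R v" "h *\<^sub>R w"] \<tau>v h by simp
    have "\<bar>f' (x + (\<tau> *\<^sub>R v + h *\<^sub>R w)) v - f' (x + \<tau> *\<^sub>R v) v - h * f'' w v\<bar>
        \<le> \<bar>f' (x + (\<tau> *\<^sub>R v + h *\<^sub>R w)) v - f' x v - f'' (\<tau> *\<^sub>R v + h *\<^sub>R w) v\<bar>
          + \<bar>f' (x + \<tau> *\<^sub>R v) v - f' x v - f'' (\<tau> *\<^sub>R v) v\<bar>"
      by (simp add: blinfun.bilinear_simps)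
    also have "\<dots> \<le> e * norm (\<tau> *\<^sub>R v + h *\<^sub>R w) * norm v + e * norm (\<tau> *\<^sub>R v) * norm v"
    proof (intro add_mono rem)
      show "norm (\<tau> *\<^sub>R v + h *\<^sub>R w) < d" using \<tau>w hn by (rule le_less_trans)
      have "0 \<le> h * norm w" using h(1) by simp
      then show "norm (\<tau> *\<^sub>R v) < d" using \<tau>v hn by linarith
    qed
    also have "\<dots> \<le> e * (h * norm v + h * norm w) * norm v + e * (h * norm v) * norm v"
      using e \<tau>v \<tau>w by (intro add_mono mult_right_mono mult_left_mono) auto
    finally have main: "\<bar>f' (x + (\<tau> *\<^sub>R v + h *\<^sub>R w)) v - f' (x + \<tau> *\<^sub>R v) v - h * f'' w v\<bar>
        \<le> e * h * ((2 * norm v + norm w) * norm v)"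
      by (simp add: algebra_simps)
    have "f (x + h *\<^sub>R v + h *\<^sub>R w) - f (x + h *\<^sub>R v) - f (x + h *\<^sub>R w) + f x - h\<^sup>2 * f'' w v
        = h * (f' (x + (\<tau> *\<^sub>R v + h *\<^sub>R w)) v - f' (x + \<tau> *\<^sub>R v) v - h * f'' w v)"
      using mv by (simp add: g_def add.assoc power2_eq_square algebra_simps)
    also have "\<bar>\<dots>\<bar> \<le> h * (e * h * ((2 * norm v + norm w) * norm v))"
      using main h(1) by (simp add: abs_mult)
    finally show "\<bar>f (x + h *\<^sub>R v + h *\<^sub>R w) - f (x + h *\<^sub>R v) - f (x + h *\<^sub>R w) + f x - h\<^sup>2 * f'' w v\<bar>
        \<le> e * h\<^sup>2 * ((2 * norm v + norm w) * norm v)"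
      by (simp add: power2_eq_square ac_simps)
  qed
qed

text \<open>The second difference is symmetric in \<open>v\<close> and \<open>w\<close>, and it has both values as its limit after
  division by \<open>h\<^sup>2\<close>.\<close>

lemma symmetric_second_derivative:
  fixes f :: "'a::real_normed_vector \<Rightarrow> real" and f'' :: "'a \<Rightarrow>\<^sub>L 'a \<Rightarrow>\<^sub>L real"
  assumes f: "\<And>y. (f has_derivative blinfun_apply (f' y)) (at y)"
    and f': "(f' has_derivative blinfun_apply f'') (at x)"
  shows "f'' v w = f'' w v"
proof -
  define M where "M = (2 * norm v + norm w) * norm v + (2 * norm w + norm v) * norm w"
  have M: "0 \<le> M" by (simp add: M_def)
  have le: "\<bar>f'' w v - f'' v w\<bar> \<le> e * M" if e: "e > 0" for e
  proof -
    obtain r where r: "r > 0" "\<And>h. 0 < h \<Longrightarrow> h < r \<Longrightarrow>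
      \<bar>f (x + h *\<^sub>R v + h *\<^sub>R w) - f (x + h *\<^sub>R v) - f (x + h *\<^sub>R w) + f x - h\<^sup>2 * f'' w v\<bar>
        \<le> e * h\<^sup>2 * ((2 * norm v + norm w) * norm v)"
      using symmetric_second_derivative_aux[OF f f' e] by blast
    obtain s where s: "s > 0" "\<And>h. 0 < h \<Longrightarrow> h < s \<Longrightarrow>
      \<bar>f (x + h *\<^sub>R w + h *\<^sub>R v) - f (x + h *\<^sub>R w) - f (x + h *\<^sub>R v) + f x - h\<^sup>2 * f'' v w\<bar>
        \<le> e * h\<^sup>2 * ((2 * norm w + norm v) * norm w)"
      using symmetric_second_derivative_aux[OF f f' e] by blast
    define h where "h = min r s / 2"
    have h: "0 < h" "h < r" "h < s" using r(1) s(1) by (auto simp: h_def)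
    have eq: "x + h *\<^sub>R w + h *\<^sub>R v = x + h *\<^sub>R v + h *\<^sub>R w" by simp
    have "\<bar>h\<^sup>2 * f'' w v - h\<^sup>2 * f'' v w\<bar>
        \<le> e * h\<^sup>2 * ((2 * norm v + norm w) * norm v) + e * h\<^sup>2 * ((2 * norm w + norm v) * norm w)"
      using r(2)[OF h(1,2)] s(2)[OF h(1,3), unfolded eq] by linarith
    also have "\<dots> = h\<^sup>2 * (e * M)" by (simp add: M_def algebra_simps)
    also have "\<bar>h\<^sup>2 * f'' w v - h\<^sup>2 * f'' v w\<bar> = h\<^sup>2 * \<bar>f'' w v - f'' v w\<bar>"
      by (simp add: right_diff_distrib[symmetric] abs_mult)
    finally show ?thesis using h(1) by simp
  qed
  have "\<bar>f'' w v - f'' v w\<bar> \<le> 0"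
  proof (rule field_le_epsilon)
    fix e :: real assume e: "0 < e"
    have "\<bar>f'' w v - f'' v w\<bar> \<le> e / (M + 1) * M" using e M by (intro le) auto
    also have "\<dots> \<le> e" using e M by (simp add: field_simps)
    finally show "\<bar>f'' w v - f'' v w\<bar> \<le> 0 + e" by simp
  qed
  then show ?thesis by simp
qed

section \<open>Hessians along a branch of critical points\<close>

lemma fderiv_works:
  assumes "f differentiable (at x)"
  shows "(f has_derivative blinfun_apply (fderiv f x)) (at x)"
  using assms unfolding fderiv_def
  by (metis bounded_linear_Blinfun_apply frechet_derivative_works has_derivative_bounded_linear)

lemma fderiv_eqI:
  assumes "(f has_derivative blinfun_apply L) (at x)"
  shows "fderiv f x = L"
  using assms by (simp add: fderiv_def frechet_derivative_at[symmetric] blinfun_apply_inverse)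

lemma C2_on_derivatives:
  assumes "C2_on UNIV f"
  shows "(f has_derivative blinfun_apply (fderiv f x)) (at x)"
    and "(fderiv f has_derivative blinfun_apply (fderiv (fderiv f) x)) (at x)"
  using assms by (auto simp: C2_on_def C1_on_def intro: fderiv_works)

lemma lagrangian_derivatives:
  fixes H :: "'e::real_normed_vector \<Rightarrow> real" and F :: "'e \<Rightarrow> 'g::real_inner"
  assumes H: "C2_on UNIV H" and F: "C2_on UNIV F"
  shows "(lagrangian H F \<xi> has_derivative
           blinfun_apply (fderiv H x - (blinfun_inner_right \<xi> o\<^sub>L fderiv F x))) (at x)"
    and "(fderiv (lagrangian H F \<xi>) has_derivative
           (\<lambda>v. fderiv (fderiv H) x v - (blinfun_inner_right \<xi> o\<^sub>L fderiv (fderiv F) x v))) (at x)"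
proof -
  have L: "(lagrangian H F \<xi> has_derivative
           blinfun_apply (fderiv H y - (blinfun_inner_right \<xi> o\<^sub>L fderiv F y))) (at y)" for y
  proof -
    have "((\<lambda>x. H x - \<xi> \<bullet> F x) has_derivative (\<lambda>v. fderiv H y v - \<xi> \<bullet> fderiv F y v)) (at y)"
      by (intro has_derivative_diff has_derivative_inner_right C2_on_derivatives(1)[OF H]
          C2_on_derivatives(1)[OF F])
    then show ?thesis by (simp add: lagrangian_def[abs_def] minus_blinfun.rep_eq)
  qed
  show "(lagrangian H F \<xi> has_derivative
           blinfun_apply (fderiv H x - (blinfun_inner_right \<xi> o\<^sub>L fderiv F x))) (at x)" by (rule L)
  have "fderiv (lagrangian H F \<xi>) = (\<lambda>y. fderiv H y - (blinfun_inner_right \<xi> o\<^sub>L fderiv F y))"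
    using L by (intro ext fderiv_eqI)
  moreover have "((\<lambda>y. blinfun_inner_right \<xi> o\<^sub>L fderiv F y) has_derivative
      (\<lambda>v. blinfun_inner_right \<xi> o\<^sub>L fderiv (fderiv F) x v)) (at x)"
    by (rule bounded_linear.has_derivative[OF bounded_bilinear.bounded_linear_right[OF bounded_bilinear_blinfun_compose]])
       (rule C2_on_derivatives[OF F])
  ultimately show "(fderiv (lagrangian H F \<xi>) has_derivative
           (\<lambda>v. fderiv (fderiv H) x v - (blinfun_inner_right \<xi> o\<^sub>L fderiv (fderiv F) x v))) (at x)"
    using has_derivative_diff[OF C2_on_derivatives(2)[OF H]] by auto
qed

lemma hessian_lagrangian:
  fixes H :: "'e::real_normed_vector \<Rightarrow> real" and F :: "'e \<Rightarrow> 'g::real_inner"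
  assumes H: "C2_on UNIV H" and F: "C2_on UNIV F"
  shows "hessian (lagrangian H F \<xi>) x v w
           = fderiv (fderiv H) x v w - \<xi> \<bullet> fderiv (fderiv F) x v w"
    and "hessian (lagrangian H F \<xi>) x v w = hessian (lagrangian H F \<xi>) x w v"
proof -
  define L2 where "L2 = fderiv (fderiv (lagrangian H F \<xi>)) x"
  note D2 = lagrangian_derivatives(2)[OF H F, of \<xi> x]
  have works: "(fderiv (lagrangian H F \<xi>) has_derivative blinfun_apply L2) (at x)"
    unfolding L2_def using D2 by (intro fderiv_works differentiableI)
  have "L2 v = fderiv (fderiv H) x v - (blinfun_inner_right \<xi> o\<^sub>L fderiv (fderiv F) x v)"
    using has_derivative_unique[OF works D2] by (rule fun_cong)
  then show "hessian (lagrangian H F \<xi>) x v w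
           = fderiv (fderiv H) x v w - \<xi> \<bullet> fderiv (fderiv F) x v w"
    by (simp add: hessian_def L2_def[symmetric] blinfun.bilinear_simps)
  have "(lagrangian H F \<xi> has_derivative blinfun_apply (fderiv (lagrangian H F \<xi>) y)) (at y)" for y
    using lagrangian_derivatives(1)[OF H F, of \<xi> y] by (intro fderiv_works differentiableI)
  then show "hessian (lagrangian H F \<xi>) x v w = hessian (lagrangian H F \<xi>) x w v"
    unfolding hessian_def L2_def[symmetric] using works
    by (rule symmetric_second_derivative)
qed

text \<open>The first identity is the derivative of the critical point equation along the branch. For the
  second one, criticality cancels the contribution of \<open>u\<close> to \<open>DW\<close>, so that \<open>DW = - F\<close> along the branch.\<close>

lemma critical_branch_hessians:
  fixes H :: "'e::real_normed_vector \<Rightarrow> real" and F :: "'e \<Rightarrow> 'g::real_inner"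
  assumes H: "C2_on UNIV H" and F: "C2_on UNIV F"
    and \<Omega>: "open \<Omega>" and u: "C1_on \<Omega> u"
    and crit: "\<And>\<zeta> v. \<zeta> \<in> \<Omega> \<Longrightarrow> fderiv H (u \<zeta>) v - \<zeta> \<bullet> fderiv F (u \<zeta>) v = 0"
    and W: "\<And>\<zeta>. \<zeta> \<in> \<Omega> \<Longrightarrow> W \<zeta> = lagrangian H F \<zeta> (u \<zeta>)"
    and \<xi>: "\<xi> \<in> \<Omega>"
  shows "hessian (lagrangian H F \<xi>) (u \<xi>) (fderiv u \<xi> \<eta>) w = \<eta> \<bullet> fderiv F (u \<xi>) w"
    and "hessian W \<xi> a b = - (b \<bullet> fderiv F (u \<xi>) (fderiv u \<xi> a))"
proof -
  have Du: "(u has_derivative fderiv u \<zeta>) (at \<zeta>)" if "\<zeta> \<in> \<Omega>" for \<zeta>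
    using u that by (auto simp: C1_on_def intro: fderiv_works)
  have DHu: "((\<lambda>\<zeta>. fderiv H (u \<zeta>)) has_derivative (\<lambda>\<eta>. fderiv (fderiv H) (u \<xi>) (fderiv u \<xi> \<eta>))) (at \<xi>)"
    by (rule has_derivative_compose[OF Du[OF \<xi>] C2_on_derivatives(2)[OF H]])
  have DFu: "((\<lambda>\<zeta>. fderiv F (u \<zeta>)) has_derivative (\<lambda>\<eta>. fderiv (fderiv F) (u \<xi>) (fderiv u \<xi> \<eta>))) (at \<xi>)"
    by (rule has_derivative_compose[OF Du[OF \<xi>] C2_on_derivatives(2)[OF F]])
  have "((\<lambda>\<zeta>. fderiv H (u \<zeta>) w - \<zeta> \<bullet> fderiv F (u \<zeta>) w) has_derivative
      (\<lambda>\<eta>. fderiv (fderiv H) (u \<xi>) (fderiv u \<xi> \<eta>) w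
        - (\<xi> \<bullet> fderiv (fderiv F) (u \<xi>) (fderiv u \<xi> \<eta>) w + \<eta> \<bullet> fderiv F (u \<xi>) w))) (at \<xi>)"
    by (intro has_derivative_diff has_derivative_inner has_derivative_ident
        bounded_linear.has_derivative[OF blinfun.bounded_linear_left] DHu DFu)
  moreover have "((\<lambda>\<zeta>. fderiv H (u \<zeta>) w - \<zeta> \<bullet> fderiv F (u \<zeta>) w) has_derivative (\<lambda>_. 0)) (at \<xi>)"
    by (rule has_derivative_transform_within_open[OF has_derivative_const[of 0] \<Omega> \<xi>]) (simp add: crit)
  ultimately have "fderiv (fderiv H) (u \<xi>) (fderiv u \<xi> \<eta>) w
        - (\<xi> \<bullet> fderiv (fderiv F) (u \<xi>) (fderiv u \<xi> \<eta>) w + \<eta> \<bullet> fderiv F (u \<xi>) w) = 0"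
    by (metis (no_types, lifting) has_derivative_unique)
  then show "hessian (lagrangian H F \<xi>) (u \<xi>) (fderiv u \<xi> \<eta>) w = \<eta> \<bullet> fderiv F (u \<xi>) w"
    by (simp add: hessian_lagrangian(1)[OF H F])
  have DW: "fderiv W \<zeta> = - blinfun_inner_left (F (u \<zeta>))" if \<zeta>: "\<zeta> \<in> \<Omega>" for \<zeta>
  proof (rule fderiv_eqI)
    have "((\<lambda>\<zeta>. H (u \<zeta>)) has_derivative (\<lambda>\<eta>. fderiv H (u \<zeta>) (fderiv u \<zeta> \<eta>))) (at \<zeta>)"
      by (rule has_derivative_compose[OF Du[OF \<zeta>] C2_on_derivatives(1)[OF H]])
    moreover have "((\<lambda>\<zeta>. F (u \<zeta>)) has_derivative (\<lambda>\<eta>. fderiv F (u \<zeta>) (fderiv u \<zeta> \<eta>))) (at \<zeta>)"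
      by (rule has_derivative_compose[OF Du[OF \<zeta>] C2_on_derivatives(1)[OF F]])
    ultimately have "((\<lambda>\<zeta>. H (u \<zeta>) - \<zeta> \<bullet> F (u \<zeta>)) has_derivative
        (\<lambda>\<eta>. fderiv H (u \<zeta>) (fderiv u \<zeta> \<eta>) - (\<zeta> \<bullet> fderiv F (u \<zeta>) (fderiv u \<zeta> \<eta>) + \<eta> \<bullet> F (u \<zeta>)))) (at \<zeta>)"
      by (intro has_derivative_diff has_derivative_inner has_derivative_ident)
    also have "(\<lambda>\<eta>. fderiv H (u \<zeta>) (fderiv u \<zeta> \<eta>) - (\<zeta> \<bullet> fderiv F (u \<zeta>) (fderiv u \<zeta> \<eta>) + \<eta> \<bullet> F (u \<zeta>)))
        = (- blinfun_inner_left (F (u \<zeta>)))"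
      using crit[OF \<zeta>] by (auto simp: fun_eq_iff blinfun.bilinear_simps algebra_simps)
    finally show "(W has_derivative (- blinfun_inner_left (F (u \<zeta>)))) (at \<zeta>)"
      by (rule has_derivative_transform_within_open[OF _ \<Omega> \<zeta>]) (simp add: W lagrangian_def)
  qed
  have "((\<lambda>\<zeta>. - blinfun_inner_left (F (u \<zeta>))) has_derivative
      (\<lambda>a. - blinfun_inner_left (fderiv F (u \<xi>) (fderiv u \<xi> a)))) (at \<xi>)"
    by (intro has_derivative_minus bounded_linear.has_derivative[OF bounded_linear_blinfun_inner_left]
        has_derivative_compose[OF Du[OF \<xi>] C2_on_derivatives(1)[OF F]])
  then have D: "(fderiv W has_derivative
      (\<lambda>a. - blinfun_inner_left (fderiv F (u \<xi>) (fderiv u \<xi> a)))) (at \<xi>)"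
    by (rule has_derivative_transform_within_open[OF _ \<Omega> \<xi>]) (simp add: DW)
  have "fderiv (fderiv W) \<xi> a = - blinfun_inner_left (fderiv F (u \<xi>) (fderiv u \<xi> a))"
    using has_derivative_unique[OF fderiv_works[OF differentiableI[OF D]] D] by (rule fun_cong)
  then show "hessian W \<xi> a b = - (b \<bullet> fderiv F (u \<xi>) (fderiv u \<xi> a))"
    by (simp add: hessian_def blinfun.bilinear_simps)
qed

section \<open>Comparison of the indices\<close>

lemma edim_span:
  assumes "finite S" and "independent S"
  shows "edim (span S) = enat (card S)"
  using assms by (auto simp: edim_def dim_eq_card_independent)

text \<open>The image under \<open>T\<close> of a positive definite subspace of \<open>Q\<close> is negative definite for \<open>B\<close>, and a
  negative direction \<open>z\<close> that is \<open>B\<close>-orthogonal to the range of \<open>T\<close> enlarges it by one dimension.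
  Strictness of the inequality rests on \<open>positive_index Q\<close> being finite, which is why the domain of \<open>T\<close>
  has a finite spanning set.\<close>

lemma positive_index_less_morse_index:
  fixes B :: "'e::real_vector \<Rightarrow> 'e \<Rightarrow> real" and Q :: "'g::real_vector \<Rightarrow> 'g \<Rightarrow> real"
  assumes B: "bilinear B" and sym: "\<And>v w. B v w = B w v"
    and T: "linear T" "inj T" and Q: "\<And>a. Q a a = - B (T a) (T a)"
    and fin: "finite S" "span S = (UNIV :: 'g set)"
    and z: "\<And>a. B (T a) z = 0" "B z z < 0"
  shows "positive_index Q < morse_index B"
proof -
  have step: "eSuc (edim V) \<le> morse_index B" and small: "edim V \<le> enat (card S)"
    if V: "subspace V" "\<And>v. v \<in> V \<Longrightarrow> v \<noteq> 0 \<Longrightarrow> Q v v > 0" for V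
  proof -
    obtain b where b: "b \<subseteq> V" "independent b" "V \<subseteq> span b"
      by (rule basis_exists)
    have finb: "finite b" and cardb: "card b \<le> card S"
      using independent_span_bound[OF fin(1) b(2)] fin(2) by auto
    have Vb: "V = span b" using b V(1) by (simp add: span_subspace)
    have edV: "edim V = enat (card b)" unfolding Vb using finb b(2) by (rule edim_span)
    then show "edim V \<le> enat (card S)" using cardb by simp
    have spT: "span (T ` b) = T ` V" by (simp add: Vb linear_span_image[OF T(1)])
    have zn: "z \<notin> T ` V" using z by auto
    define b' where "b' = insert z (T ` b)"
    have indT: "independent (T ` b)"
      by (intro linear_independent_injective_image[OF T(1) b(2)] inj_on_subset[OF T(2)]) simp
    have ind: "independent b'"
      unfolding b'_def using indT zn spT by (intro independent_insertI) auto
    have "z \<notin> T ` b" using zn b(1) by auto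
    then have card: "card b' = Suc (card b)"
      using finb by (simp add: b'_def card_image[OF inj_on_subset[OF T(2) subset_UNIV]])
    have neg: "B v v < 0" if v: "v \<in> span b'" "v \<noteq> 0" for v
    proof -
      obtain c where "v - c *\<^sub>R z \<in> T ` V"
        using v(1) unfolding b'_def span_insert spT by blast
      then obtain a where "a \<in> V" "v - c *\<^sub>R z = T a" by blast
      then have a: "a \<in> V" "v = T a + c *\<^sub>R z" by (auto simp: diff_eq_eq)
      have "B v v = c\<^sup>2 * B z z - Q a a"
        by (simp add: a Q bilinear_ladd[OF B] bilinear_radd[OF B] bilinear_lmul[OF B]
            bilinear_rmul[OF B] z(1) sym[of z "T a"] power2_eq_square)
      moreover have "c\<^sup>2 * B z z \<le> 0" using z(2) by (simp add: mult_nonneg_nonpos)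
      moreover have "c\<^sup>2 * B z z < 0" if "c \<noteq> 0"
        using z(2) that by (simp add: mult_pos_neg)
      moreover have "a \<noteq> 0" if "c = 0" using v(2) a(2) that linear_0[OF T(1)] by auto
      moreover have "Q 0 0 = 0" using Q[of 0] by (simp add: linear_0[OF T(1)] bilinear_lzero[OF B])
      moreover have "Q a a > 0" if "a \<noteq> 0" using V(2)[OF a(1) that] .
      ultimately show ?thesis by (cases "c = 0"; cases "a = 0") force+
    qed
    have "eSuc (edim V) = edim (span b')"
      using edim_span[OF _ ind] finb by (simp add: card edV eSuc_enat) (simp add: b'_def)
    also have "\<dots> \<le> morse_index B"
      unfolding morse_index_def using neg by (intro SUP_upper) auto
    finally show "eSuc (edim V) \<le> morse_index B" .
  qed
  show ?thesis
  proof (cases "morse_index B")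
    case (enat m)
    have "eSuc (edim ({0} :: 'g set)) \<le> morse_index B" by (rule step) auto
    then obtain k where k: "m = Suc k"
      using enat by (cases m) (auto simp: zero_enat_def[symmetric])
    have "positive_index Q \<le> enat k"
      unfolding positive_index_def
    proof (rule SUP_least)
      fix V assume "V \<in> {V. subspace V \<and> (\<forall>v\<in>V. v \<noteq> 0 \<longrightarrow> Q v v > 0)}"
      then have "eSuc (edim V) \<le> eSuc (enat k)" using step[of V] by (simp add: enat k eSuc_enat)
      then show "edim V \<le> enat k" by simp
    qed
    also have "\<dots> < morse_index B" by (simp add: enat k)
    finally show ?thesis .
  next
    case infinity
    have "positive_index Q \<le> enat (card S)"
      unfolding positive_index_def by (rule SUP_least) (use small in auto)
    also have "\<dots> < morse_index B" by (simp add: infinity)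
    finally show ?thesis .
  qed
qed

section \<open>Coercivity of the Hessian of the Lagrangian\<close>

theorem theorem3p1:
  fixes D :: "'e::{real_inner,banach} set"
    and J :: "'e \<Rightarrow>\<^sub>L 'e \<Rightarrow>\<^sub>L real"
    and H :: "'e \<Rightarrow> real"
    and G :: "(complex^'n^'n) set"
    and \<iota> :: "'g::real_inner \<Rightarrow> complex^'n^'n"
    and \<Phi> :: "complex^'n^'n \<Rightarrow> 'e \<Rightarrow> 'e"
    and F :: "'e \<Rightarrow> 'g"
    and \<Omega> :: "'g set"
    and u :: "'g \<Rightarrow> 'e"
    and W :: "'g \<Rightarrow> real"
    and \<xi> :: 'g
  assumes "symplectic_triple D J"
    and "C2_on UNIV H" and "H \<in> Dif D J"
    and "matrix_lie_group G" and "connected G" and "lie_coordinates G \<iota>"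
    and "globally_hamiltonian G \<iota> D J \<Phi> F"
    and "Ad_star_equivariant G \<iota> \<Phi> F"
    and "C2_on UNIV F"
    and "\<And>g. g \<in> G \<Longrightarrow> H \<circ> \<Phi> g = H"
    and "open \<Omega>" and "C1_on \<Omega> u" and "\<And>\<zeta>. \<zeta> \<in> \<Omega> \<Longrightarrow> u \<zeta> \<in> D"
    and "\<And>\<zeta> v. \<zeta> \<in> \<Omega> \<Longrightarrow>
           blinfun_apply (fderiv H (u \<zeta>)) v - \<zeta> \<bullet> blinfun_apply (fderiv F (u \<zeta>)) v = 0"
    and "\<And>\<zeta>. \<zeta> \<in> \<Omega> \<Longrightarrow> W \<zeta> = lagrangian H F \<zeta> (u \<zeta>)"
    and "\<xi> \<in> \<Omega>"
    and i: "nondegenerate (hessian W \<xi>)"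
    and ii: "form_kernel (hessian (lagrangian H F \<xi>) (u \<xi>)) = tangent_orbit G \<iota> \<Phi> F (u \<xi>)"
    and iii: "Inf (ereal ` (spectrum (hessian_op (lagrangian H F \<xi>) (u \<xi>)) \<inter> {0<..})) > 0"
    and iv: "positive_index (hessian W \<xi>) = morse_index (hessian (lagrangian H F \<xi>) (u \<xi>))"
  shows "\<exists>\<delta>>0. \<forall>v \<in> tangent_level F (u \<xi>) \<inter> (tangent_orbit G \<iota> \<Phi> F (u \<xi>))\<^sup>\<bottom>.
           hessian (lagrangian H F \<xi>) (u \<xi>) v v \<ge> \<delta> * (norm v)\<^sup>2"
proof -
  define B where "B = hessian (lagrangian H F \<xi>) (u \<xi>)"
  define A where "A = hessian_op (lagrangian H F \<xi>) (u \<xi>)"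
  define T where "T = fderiv u \<xi>"
  have AB: "v \<bullet> A w = B v w" for v w unfolding A_def B_def by (rule hessian_op_works)
  have symB: "B v w = B w v" for v w
    unfolding B_def by (rule hessian_lagrangian(2)[OF \<open>C2_on UNIV H\<close> \<open>C2_on UNIV F\<close>])
  have sa: "A v \<bullet> w = v \<bullet> A w" for v w by (metis AB symB inner_commute)
  note branch = critical_branch_hessians[OF \<open>C2_on UNIV H\<close> \<open>C2_on UNIV F\<close> \<open>open \<Omega>\<close> \<open>C1_on \<Omega> u\<close>
      assms(14,15) \<open>\<xi> \<in> \<Omega>\<close>, folded B_def T_def]
  have BT: "B (T \<eta>) w = \<eta> \<bullet> fderiv F (u \<xi>) w" for \<eta> w using branch(1) .
  have WB: "hessian W \<xi> a b = - B (T a) (T b)" for a b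
    by (simp add: branch(2) BT[symmetric] symB[of "T b"])
  have nondeg: "a = 0" if "\<And>b. B (T b) (T a) = 0" for a
  proof -
    have "a \<in> form_kernel (hessian W \<xi>)"
      using that by (simp add: form_kernel_def WB symB[of "T a"])
    then show ?thesis using i by (simp add: nondegenerate_def)
  qed
  have linT: "linear T" by (intro bounded_linear.linear blinfun.bounded_linear_right)
  have bilB: "bilinear B"
    by (simp add: bilinear_def linear_iff AB[symmetric] blinfun.bilinear_simps inner_add_left inner_add_right)
  have injT: "inj T"
    unfolding linear_injective_0[OF linT]
  proof (intro allI impI)
    fix a assume "T a = 0"
    then show "a = 0" by (intro nondeg) (simp add: bilinear_rzero[OF bilB])
  qed
  have lin_\<iota>: "linear \<iota>" "inj \<iota>" using \<open>lie_coordinates G \<iota>\<close> by (auto simp: lie_coordinates_def)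
  obtain j where j: "linear j" "j \<circ> \<iota> = id"
    using linear_injective_left_inverse[OF lin_\<iota>] by blast
  have surj_j: "surj j" using j(2) by (metis comp_apply id_apply surjI)
  \<comment> \<open>Composition with \<open>j\<close> parametrises the Lie algebra by a Euclidean space, as \<open>form_coercive\<close>
      requires; the redundant parameters do not change the range of \<open>T\<close>.\<close>
  have fin: "finite (j ` Basis)" "span (j ` Basis) = UNIV"
    using surj_j by (auto simp: linear_span_image[OF j(1)])
  have nonneg: "0 \<le> z \<bullet> A z" if "\<And>a. B (T a) z = 0" for z
  proof (rule ccontr)
    assume "\<not> 0 \<le> z \<bullet> A z"
    then have "positive_index (hessian W \<xi>) < morse_index B"
      using that by (intro positive_index_less_morse_index[OF bilB symB linT injT _ fin]) (auto simp: WB AB)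
    then show False using iv by (simp add: B_def)
  qed
  obtain c where c: "0 < c" "\<And>s. 0 < s \<Longrightarrow> s < c \<Longrightarrow> s \<notin> spectrum A"
    using positive_spectrum_gap[OF iii] unfolding A_def by blast
  have "\<exists>\<delta>>0. \<forall>v. (\<forall>k. T (j k) \<bullet> A v = 0) \<longrightarrow> (\<forall>k. A k = 0 \<longrightarrow> k \<bullet> v = 0)
           \<longrightarrow> \<delta> * (norm v)\<^sup>2 \<le> v \<bullet> A v"
  proof (rule form_coercive[OF sa c(1)])
    show "c * (x \<bullet> A x) \<le> (norm (A x))\<^sup>2" for x by (rule spectral_gap_inequality[OF sa c(2,1)])
    show "linear (\<lambda>k. T (j k))" using linear_compose[OF j(1) linT] by (simp add: o_def)
    have all: "P a" if "\<And>k. P (j k)" for P and a :: 'g using surj_j that by (metis surjD)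
    show "T (j k) = 0" if "\<And>l. T (j l) \<bullet> A (T (j k)) = 0" for k
    proof -
      have "B (T b) (T (j k)) = 0" for b by (rule all) (use that in \<open>simp add: AB\<close>)
      then have "j k = 0" by (rule nondeg)
      then show ?thesis by (simp add: linear_0[OF linT])
    qed
    show "0 \<le> z \<bullet> A z" if "\<And>k. T (j k) \<bullet> A z = 0" for z
    proof (rule nonneg)
      show "B (T a) z = 0" for a by (rule all) (use that in \<open>simp add: AB\<close>)
    qed
  qed
  then obtain \<delta> where \<delta>: "\<delta> > 0" and coer: "\<And>v. (\<And>a. B (T a) v = 0) \<Longrightarrow>
      (\<And>k. A k = 0 \<Longrightarrow> k \<bullet> v = 0) \<Longrightarrow> \<delta> * (norm v)\<^sup>2 \<le> B v v"
    by (auto simp: AB)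
  have "\<delta> * (norm v)\<^sup>2 \<le> B v v"
    if v: "v \<in> tangent_level F (u \<xi>)" "v \<in> (tangent_orbit G \<iota> \<Phi> F (u \<xi>))\<^sup>\<bottom>" for v
  proof (rule coer)
    show "B (T a) v = 0" for a using v(1) by (simp add: BT tangent_level_def)
    fix k assume "A k = 0"
    then have "k \<in> form_kernel B" by (simp add: form_kernel_def AB[symmetric] sa[symmetric])
    then show "k \<bullet> v = 0" using v(2) ii by (auto simp: B_def orthogonal_comp_def orthogonal_def)
  qed
  then show ?thesis using \<delta> by (auto simp: B_def)
qed

end
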